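(* Let $n\ge 1$ and let $K_1,\dots,K_n,L_1,\dots,L_n\subset\mathbb{R}^n$ be convex bodies with $0$ in their interiors. Suppose that for every $\lambda_1,\dots,\lambda_n>0$ and every fractional linear map $F$ on $\mathbb{R}^n$ that is admissible for $\lambda_1K_1,\dots,\lambda_nK_n,\lambda_1L_1,\dots,\lambda_nL_n$ (i.e. all these bodies are contained in $\mathrm{Dom}(F)$) one has $$V(F(\lambda_1K_1),\dots,F(\lambda_nK_n))\le V(F(\lambda_1L_1),\dots,F(\lambda_nL_n)).$$ Then $K_i\subseteq L_i$ for every $1\le i\le n$.
   Context: A convex body in $\mathbb{R}^n$ is a compact convex set with non-empty interior. $V$ denotes the $n$-dimensional mixed volume. A fractional linear map on $\mathbb{R}^n$ is a map of the form $F(x)=\frac{Mx+b}{\langle x,c\rangle+d}$, where $M$ is a linear operator on $\mathbb{R}^n$, $b,c\in\mathbb{R}^n$, $d\in\mathbb{R}$, and the $(n+1)\times(n+1)$ matrix $\begin{pmatrix} M & b\\ c & d\end{pmatrix}$ is invertible. If $c=0$ the map is affine and $\mathrm{Dom}(F)=\mathbb{R}^n$. If $c\neq 0$, the map is undefined on the affine hyperplane $H=\{x:\langle x,c\rangle+d=0\}$, and $F$ is considered on one side of $H$, i.e. $\mathrm{Dom}(F)$ is one of the two open half-spaces bounded by $H$. Fractional linear maps send convex bodies contained in their domain to convex bodies. *)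

theory Defs
  imports "HOL-Analysis.Analysis" "HOL-Library.Set_Algebras" "HOL-Combinatorics.Permutations"
begin

definition convex_body :: "'a::euclidean_space set \<Rightarrow> bool" where
  "convex_body K \<longleftrightarrow> compact K \<and> convex K \<and> interior K \<noteq> {}"

text \<open>
  By Minkowski's theorem, for compact convex sets \<open>K\<^sub>1, \<dots>, K\<^sub>n\<close> in n-space the volume of
  \<open>t\<^sub>1 K\<^sub>1 + \<dots> + t\<^sub>n K\<^sub>n\<close> is, for \<open>t\<^sub>1, \<dots>, t\<^sub>n \<ge> 0\<close>, a homogeneous polynomial of degree n, written
  \<open>\<Sum> V(K\<^bsub>j(1)\<^esub>, \<dots>, K\<^bsub>j(n)\<^esub>) t\<^bsub>j(1)\<^esub> \<cdots> t\<^bsub>j(n)\<^esub>\<close>, where \<open>j\<close> ranges over all maps from the index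
  set to itself and the coefficients are symmetric, which makes them unique. The predicate below
  says that \<open>a\<close> is this coefficient family, \<open>a j\<close> standing for \<open>V(K\<^bsub>j(1)\<^esub>, \<dots>, K\<^bsub>j(n)\<^esub>)\<close>.
  Sums of sets are Minkowski sums (theory \<open>Set_Algebras\<close>).
\<close>

definition minkowski_coeffs ::
    "('n::finite \<Rightarrow> (real^'n) set) \<Rightarrow> (('n \<Rightarrow> 'n) \<Rightarrow> real) \<Rightarrow> bool" where
  "minkowski_coeffs K a \<longleftrightarrow>
     (\<forall>j p. p permutes UNIV \<longrightarrow> a (j \<circ> p) = a j) \<and>
     (\<forall>t. (\<forall>i. 0 \<le> t i) \<longrightarrow>
        measure lebesgue (\<Sum>i\<in>UNIV. (\<lambda>x. t i *\<^sub>R x) ` K i)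
          = (\<Sum>j\<in>UNIV. a j * (\<Prod>k\<in>UNIV. t (j k))))"

text \<open>
  The mixed volume \<open>V(K\<^sub>1, \<dots>, K\<^sub>n)\<close> is the coefficient with index map \<open>j = id\<close>. The bodies are
  indexed by the coordinate type, so their number is the dimension.
\<close>

definition mixed_volume :: "('n::finite \<Rightarrow> (real^'n) set) \<Rightarrow> real" where
  "mixed_volume K = (THE v. \<exists>a. minkowski_coeffs K a \<and> v = a id)"

text \<open>The block matrix with rows \<open>(M, b)\<close> and \<open>(c, d)\<close>; \<open>Inr ()\<close> is the additional index.\<close>

definition block_matrix ::
    "real^'n^'n \<Rightarrow> real^'n \<Rightarrow> real^'n \<Rightarrow> real \<Rightarrow> real^('n::finite + unit)^('n + unit)" where
  "block_matrix M b c d = (\<chi> r s.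
     case r of
       Inl i \<Rightarrow> (case s of Inl j \<Rightarrow> M $ i $ j | Inr _ \<Rightarrow> b $ i)
     | Inr _ \<Rightarrow> (case s of Inl j \<Rightarrow> c $ j | Inr _ \<Rightarrow> d))"

text \<open>
  A fractional linear map is considered together with its domain \<open>D\<close>, since for \<open>c \<noteq> 0\<close> either of
  the two sides of the hyperplane may be chosen. The values of \<open>F\<close> outside \<open>D\<close> are irrelevant.
\<close>

definition fractional_linear_map ::
    "(real^'n::finite) set \<Rightarrow> (real^'n \<Rightarrow> real^'n) \<Rightarrow> bool" where
  "fractional_linear_map D F \<longleftrightarrow> (\<exists>M b c d.
     invertible (block_matrix M b c d) \<and>
     (if c = 0 then D = UNIV
      else D = {x. x \<bullet> c + d > 0} \<or> D = {x. x \<bullet> c + d < 0}) \<and>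
     (\<forall>x\<in>D. F x = (1 / (x \<bullet> c + d)) *\<^sub>R (M *v x + b)))"

end

theory Submission
  imports Defs
begin

text \<open>
  Mixed volumes are represented by transport. For a convex body \<open>A\<close> with a dense sequence of points
  \<open>a\<^sub>k\<close>, the gradient of \<open>\<phi> x = ln (\<Sum>k. (1/2)^(k+1) * exp (x \<bullet> a\<^sub>k))\<close> maps the whole space onto \<open>A\<close>
  up to its boundary, and for several bodies \<open>\<nabla>(\<Sum>i. t\<^sub>i \<phi>\<^sub>i)\<close> maps it onto the Minkowski sum
  \<open>\<Sum>i. t\<^sub>i A\<^sub>i\<close>. Changing variables, the volume of this sum is the integral of the determinant of
  \<open>\<Sum>i. t\<^sub>i Hess \<phi>\<^sub>i\<close>, which is a polynomial in \<open>t\<close>; so the mixed volume exists and is the integral of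
  the mixed discriminant of the Hessians. The latter is nonnegative and monotone on positive
  semidefinite matrices. If \<open>A\<^sub>i\<close> lies in a fixed ball and contains \<open>0\<close> and \<open>w\<^sub>i\<close>, its potential can be
  chosen with Hessian at least a fixed multiple of \<open>w\<^sub>i w\<^sub>i\<^sup>T\<close> on the unit ball, hence
  \<open>V(A\<^sub>1, \<dots>, A\<^sub>n)\<close> is at least a constant times \<open>det(w\<^sub>1, \<dots>, w\<^sub>n)\<^sup>2\<close>.

  If \<open>K\<^sub>m\<close> is not contained in \<open>L\<^sub>m\<close>, some \<open>u\<close> is larger at a point \<open>x\<^sub>0\<close> of \<open>K\<^sub>m\<close>, where it has its
  maximum \<open>h\<close> over \<open>K\<^sub>m\<close>, than anywhere on \<open>L\<^sub>m\<close>. Shrink all other bodies into \<open>{x. x \<bullet> u \<le> h / 2}\<close> and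
  apply \<open>F x = x / (h + \<epsilon> - x \<bullet> u)\<close>. As \<open>\<epsilon>\<close> tends to \<open>0\<close>, the images of the \<open>L\<^sub>i\<close> stay bounded, while
  \<open>\<epsilon> F(K\<^sub>m)\<close> stays bounded but contains \<open>x\<^sub>0\<close>, so that the left mixed volume grows like \<open>1 / \<epsilon>\<close>.
\<close>

section \<open>Change of variables for arbitrary finite index types\<close>

typedef 'a wo = "UNIV :: 'a set" morphisms of_wo to_wo by blast

lemma bij_of_wo: "bij of_wo"
  by (metis UNIV_I bij_betwI' of_wo_inject to_wo_inverse)

instance wo :: (finite) finite
proof
  show "finite (UNIV :: 'a wo set)"
    using bij_of_wo bij_betw_finite finite by blast
qed

text \<open>Any injection into the naturals serves; pulling their order back along it gives a
  well-order. It is put on the copy so that the given type receives no order.\<close>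

definition wo_rank :: "'a::finite wo \<Rightarrow> nat" where
  "wo_rank = (SOME f. inj f)"

lemma inj_wo_rank: "inj wo_rank"
proof -
  have "\<exists>f :: 'a wo \<Rightarrow> nat. inj f"
    using finite_imp_inj_to_nat_seg[OF finite] by auto
  then show ?thesis unfolding wo_rank_def by (rule someI_ex)
qed

instantiation wo :: (finite) wellorder
begin

definition "x \<le> y \<longleftrightarrow> wo_rank x \<le> wo_rank y"
definition "x < y \<longleftrightarrow> wo_rank x < wo_rank y"

instance
proof
  fix P :: "'a wo \<Rightarrow> bool" and a :: "'a wo"
  assume step: "\<And>x. (\<And>y. y < x \<Longrightarrow> P y) \<Longrightarrow> P x"
  show "P a"
    by (induction a rule: measure_induct_rule[of wo_rank]) (auto intro: step simp: less_wo_def)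
qed (auto simp: less_eq_wo_def less_wo_def dest: injD[OF inj_wo_rank])

end

section \<open>Permuting coordinates along a bijection of index types\<close>

definition reindex :: "('m \<Rightarrow> 'n) \<Rightarrow> real^'n \<Rightarrow> real^'m" where
  "reindex r x = (\<chi> i. x $ r i)"

lemma reindex_nth [simp]: "reindex r x $ i = x $ r i"
  by (simp add: reindex_def)

lemma linear_reindex: "linear (reindex r)"
  by (rule linearI) (simp_all add: vec_eq_iff)

lemma reindex_reindex_inv:
  assumes "bij r"
  shows "reindex r (reindex (inv r) x) = x" and "reindex (inv r) (reindex r y) = y"
  using assms by (simp_all add: vec_eq_iff bij_is_surj surj_f_inv_f bij_is_inj inv_f_f)

lemma image_reindex_cbox:
  fixes r :: "'m::finite \<Rightarrow> 'n::finite"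
  assumes "bij r"
  shows "reindex r ` cbox a b = cbox (reindex r a) (reindex r b)"
proof -
  have "x \<in> reindex r ` cbox a b" if "x \<in> cbox (reindex r a) (reindex r b)" for x
  proof
    show "x = reindex r (reindex (inv r) x)" using assms by (simp add: reindex_reindex_inv)
    show "reindex (inv r) x \<in> cbox a b"
      using that assms unfolding mem_box_cart
      by (metis bij_is_surj reindex_nth surj_f_inv_f)
  qed
  then show ?thesis by (auto simp: mem_box_cart)
qed

lemma norm_reindex:
  fixes r :: "'m::finite \<Rightarrow> 'n::finite"
  assumes "bij r"
  shows "norm (reindex r x) = norm x"
proof -
  have "(\<Sum>i\<in>UNIV. (norm (x $ r i))\<^sup>2) = (\<Sum>j\<in>UNIV. (norm (x $ j))\<^sup>2)"
    using assms by (intro sum.reindex_bij_betw)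
  then show ?thesis by (simp add: norm_vec_def L2_set_def)
qed

lemma image_reindex_ball:
  fixes r :: "'m::finite \<Rightarrow> 'n::finite"
  assumes "bij r"
  shows "ball 0 B \<subseteq> reindex r ` ball 0 B"
proof
  fix x :: "real^'m" assume "x \<in> ball 0 B"
  moreover have "x = reindex r (reindex (inv r) x)" using assms by (simp add: reindex_reindex_inv)
  moreover have "norm (reindex (inv r) x) = norm x"
    by (rule norm_reindex) (use assms in \<open>simp add: bij_imp_bij_inv\<close>)
  ultimately show "x \<in> reindex r ` ball 0 B"
    by (metis image_eqI mem_ball_0)
qed

text \<open>A bijective reindexing maps boxes to boxes of the same content, which transfers
  integrals over boxes, and is an isometry, so that "all boxes containing a large ball" means the
  same on both sides.\<close>

lemma has_integral_reindex:
  fixes r :: "'m::finite \<Rightarrow> 'n::finite" and f :: "real^'m \<Rightarrow> real"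
  assumes r: "bij r" and f: "(f has_integral I) UNIV"
  shows "((\<lambda>x. f (reindex r x)) has_integral I) UNIV"
proof -
  have ir: "bij (inv r)" using r by (rule bij_imp_bij_inv)
  have nbox: "\<not> (\<exists>a b :: real^'k::finite. UNIV = cbox a b)"
    by (metis bounded_cbox not_bounded_UNIV)
  have cont: "continuous (at x) (reindex r :: real^'n \<Rightarrow> real^'m)" for x
    by (intro linear_continuous_at linear_conv_bounded_linear[THEN iffD1] linear_reindex)
  have content: "measure lborel (reindex r ` cbox u v) = 1 * measure lborel (cbox u v)" for u v
  proof (cases "cbox u v = {}")
    case False
    have "(\<Prod>i\<in>UNIV. v $ r i - u $ r i) = (\<Prod>j\<in>UNIV. v $ j - u $ j)"
      using r by (rule prod.reindex_bij_betw)
    moreover have "cbox (reindex r u) (reindex r v) \<noteq> {}"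
      using False image_reindex_cbox[OF r, of u v] by auto
    ultimately show ?thesis
      using False by (simp add: image_reindex_cbox[OF r] content_cbox_cart)
  qed simp
  have step: "\<exists>z. ((\<lambda>x. f (reindex r x)) has_integral z) (cbox a b) \<and> norm (z - I) < e"
    if B: "\<forall>a b. ball 0 B \<subseteq> cbox a b \<longrightarrow> (\<exists>z. (f has_integral z) (cbox a b) \<and> norm (z - I) < e)"
      and ab: "ball 0 B \<subseteq> cbox a b" for a b B e
  proof -
    have "ball 0 B \<subseteq> cbox (reindex r a) (reindex r b)"
      using image_reindex_ball[OF r, of B] ab image_reindex_cbox[OF r, of a b] by blast
    then obtain z where z: "(f has_integral z) (cbox (reindex r a) (reindex r b))" "norm (z - I) < e"
      using B by blast
    have "((\<lambda>x. f (reindex r x)) has_integral (1 / 1) *\<^sub>R z)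
        (reindex (inv r) ` cbox (reindex r a) (reindex r b))"
    proof (rule has_integral_twiddle[OF _ _ _ cont _ _ content z(1)])
      show "\<exists>w z. reindex r ` cbox u v = cbox w z" for u v
        using image_reindex_cbox[OF r] by blast
      show "\<exists>w z. reindex (inv r) ` cbox u v = cbox w z" for u v
        using image_reindex_cbox[OF ir] by blast
    qed (use r in \<open>auto simp: reindex_reindex_inv\<close>)
    moreover have "reindex (inv r) ` cbox (reindex r a) (reindex r b) = cbox a b"
      by (simp add: image_reindex_cbox[OF ir] reindex_reindex_inv[OF r])
    ultimately show ?thesis using z(2) by auto
  qed
  have "\<exists>B>0. \<forall>a b. ball 0 B \<subseteq> cbox a b
      \<longrightarrow> (\<exists>z. ((\<lambda>x. f (reindex r x)) has_integral z) (cbox a b) \<and> norm (z - I) < e)" if "e > 0" for e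
  proof -
    obtain B where "B > 0" "\<forall>a b. ball 0 B \<subseteq> cbox a b
        \<longrightarrow> (\<exists>z. (f has_integral z) (cbox a b) \<and> norm (z - I) < e)"
      by (rule has_integral_altD[OF f nbox \<open>e > 0\<close>]) simp
    then show ?thesis using step by blast
  qed
  then show ?thesis
    by (subst has_integral_alt) (simp only: nbox if_False UNIV_I if_True, blast)
qed

text \<open>Conjugation by \<open>r\<close> is a bijection between the two permutation groups that
  preserves signs, so the Leibniz sums agree term by term.\<close>

lemma det_reindex:
  fixes r :: "'m::finite \<Rightarrow> 'n::finite" and A :: "real^'n^'n"
  assumes "bij r"
  shows "det (\<chi> i j. A $ r i $ r j :: real^'m^'m) = det A"
proof -
  have bij: "bij_betw (map_permutation UNIV r) {p. p permutes UNIV} {p. p permutes UNIV}"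
  proof (rule bij_betw_byWitness[where f' = "map_permutation UNIV (inv r)"])
    have inv: "inv_into UNIV (inv r) = r" using assms by (rule inv_inv_eq)
    show "\<forall>p\<in>{p. p permutes UNIV}. map_permutation UNIV (inv r) (map_permutation UNIV r p) = p"
      using assms by (auto intro!: map_permutation_compose_inv simp: bij_is_inj)
    show "\<forall>p\<in>{p. p permutes UNIV}. map_permutation UNIV r (map_permutation UNIV (inv r) p) = p"
      using assms by (auto intro!: map_permutation_compose_inv simp: bij_imp_bij_inv bij_is_surj surj_f_inv_f)
  qed (use assms in \<open>auto intro!: map_permutation_permutes simp: bij_imp_bij_inv\<close>)
  have "det A = (\<Sum>p | p permutes UNIV. of_int (sign (map_permutation UNIV r p))
      * (\<Prod>i\<in>UNIV. A $ i $ map_permutation UNIV r p i))"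
    unfolding det_def by (rule sum.reindex_bij_betw[OF bij, symmetric])
  also have "\<dots> = (\<Sum>p | p permutes UNIV. of_int (sign p) * (\<Prod>i\<in>UNIV. A $ r i $ r (p i)))"
  proof (rule sum.cong[OF refl], clarify)
    fix p :: "'m \<Rightarrow> 'm" assume p: "p permutes UNIV"
    have "(\<Prod>i\<in>UNIV. A $ i $ map_permutation UNIV r p i) =
        (\<Prod>i\<in>UNIV. A $ r i $ map_permutation UNIV r p (r i))"
      using assms by (rule prod.reindex_bij_betw[symmetric])
    then show "of_int (sign (map_permutation UNIV r p)) *
          (\<Prod>i\<in>UNIV. A $ i $ map_permutation UNIV r p i) =
        of_int (sign p) * (\<Prod>i\<in>UNIV. A $ r i $ r (p i))"
      using assms p by (simp add: sign_map_permutation bij_is_inj map_permutation_apply)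
  qed
  finally show ?thesis by (simp add: det_def)
qed

text \<open>The library proves this for well-ordered index types only; a well-ordered copy of the index type
  reduces the general case to that one.\<close>

lemma has_integral_det_image:
  fixes f :: "real^'n::finite \<Rightarrow> real^'n"
  assumes der: "\<And>x. (f has_derivative (*v) (f' x)) (at x)"
    and inj: "inj f" and meas: "range f \<in> lmeasurable"
  shows "((\<lambda>x. \<bar>det (f' x)\<bar>) has_integral measure lebesgue (range f)) UNIV"
proof -
  define r :: "'n wo \<Rightarrow> 'n" where "r = of_wo"
  define P :: "real^'n \<Rightarrow> real^'n wo" where "P = reindex r"
  define Q :: "real^'n wo \<Rightarrow> real^'n" where "Q = reindex (inv r)"
  have r: "bij r" unfolding r_def by (rule bij_of_wo)
  have ir: "bij (inv r)" using r by (rule bij_imp_bij_inv)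
  have PQ [simp]: "P (Q x) = x" and QP [simp]: "Q (P y) = y" for x y
    unfolding P_def Q_def using r by (simp_all add: reindex_reindex_inv)
  define g where "g = (\<lambda>x. P (f (Q x)))"
  define g' where "g' = (\<lambda>x h. P (f' (Q x) *v Q h))"
  have linP: "bounded_linear P" and linQ: "bounded_linear Q"
    unfolding P_def Q_def by (auto simp: linear_conv_bounded_linear[symmetric] linear_reindex)
  have der_g: "(g has_derivative g' x) (at x within UNIV)" for x
  proof -
    have Q: "(Q has_derivative Q) (at x)"
      by (rule bounded_linear_imp_has_derivative[OF linQ])
    have "((\<lambda>x. f (Q x)) has_derivative (\<lambda>h. f' (Q x) *v Q h)) (at x)"
      using has_derivative_compose[OF Q der] .
    from bounded_linear.has_derivative[OF linP this] show ?thesis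
      unfolding g_def g'_def by simp
  qed
  have inj_g: "inj g"
    unfolding g_def by (rule injI) (metis PQ QP inj injD)
  have range_g: "range g = P ` range f"
  proof -
    have "range Q = UNIV" by (metis QP surjI)
    moreover have "range g = P ` f ` range Q" by (simp only: g_def image_image)
    ultimately show ?thesis by simp
  qed
  \<comment> \<open>The measure of \<open>range g\<close> is found by reindexing the integral of the
    indicator function of \<open>range f\<close>.\<close>
  have "(indicat_real (range f) has_integral measure lebesgue (range f)) UNIV"
    using meas by (simp add: lmeasurable_iff_has_integral)
  from has_integral_reindex[OF ir this]
  have "((\<lambda>x. indicat_real (range f) (Q x)) has_integral measure lebesgue (range f)) UNIV"
    by (simp add: Q_def)
  moreover have "indicat_real (range f) (Q x) = indicat_real (range g) x" for x
  proof -
    have "Q x \<in> range f \<longleftrightarrow> x \<in> P ` range f"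
      by (metis PQ QP imageE imageI)
    then show ?thesis by (simp add: range_g indicator_def)
  qed
  ultimately have ind: "(indicat_real (range g) has_integral measure lebesgue (range f)) UNIV"
    by simp
  then have g: "range g \<in> lmeasurable"
    using lmeasurable_iff_indicator_has_integral[of "range g"] by auto
  then have "measure lebesgue (range g) = measure lebesgue (range f)"
    using has_integral_unique[OF ind] by (simp add: lmeasurable_iff_has_integral)
  with g have "((\<lambda>x. \<bar>det (matrix (g' x))\<bar>) has_integral measure lebesgue (range f)) UNIV"
    using has_measure_differentiable_image[of UNIV g g' "measure lebesgue (range f)", OF _ der_g inj_g] by simp
  moreover have "det (matrix (g' x)) = det (f' (Q x))" for x
  proof -
    have ax: "Q (axis j 1) = axis (r j) 1" for j
      using r by (auto simp: Q_def vec_eq_iff axis_def bij_is_inj bij_is_surj surj_f_inv_f)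
    have "matrix (g' x) $ i $ j = f' (Q x) $ r i $ r j" for i j
      by (simp add: matrix_def g'_def P_def ax matrix_vector_mult_basis column_def)
    then have "matrix (g' x) = (\<chi> i j. f' (Q x) $ r i $ r j)"
      by (simp add: vec_eq_iff)
    then show ?thesis using det_reindex[OF r] by simp
  qed
  ultimately have "((\<lambda>x. \<bar>det (f' (Q x))\<bar>) has_integral measure lebesgue (range f)) UNIV"
    by simp
  from has_integral_reindex[OF r this] have "((\<lambda>x. \<bar>det (f' (Q (P x)))\<bar>) has_integral measure lebesgue (range f)) UNIV"
    by (simp only: P_def)
  then show ?thesis by (simp only: QP)
qed

section \<open>Mixed discriminants\<close>

text \<open>Inclusion-exclusion: expand the product over \<open>i\<close> of \<open>1 + x i\<close>,
  where \<open>x i\<close> is 0 on \<open>R\<close> and -1 elsewhere. A single index outside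
  \<open>R\<close> makes the product vanish.\<close>

lemma sum_signed_of_bool_subset:
  fixes R :: "'n::finite set"
  shows "(\<Sum>S\<in>UNIV. (- 1) ^ card (- S) * of_bool (R \<subseteq> S)) = (of_bool (R = UNIV) :: real)"
proof -
  have "(\<Prod>i\<in>UNIV. 1 + (if i \<in> R then 0 else - 1 :: real)) =
      (\<Sum>S\<in>Pow UNIV. (\<Prod>i\<in>S. 1) * (\<Prod>i\<in>UNIV - S. if i \<in> R then 0 else - 1))"
    by (rule prod_add) simp
  also have "\<dots> = (\<Sum>S\<in>UNIV. (- 1) ^ card (- S) * of_bool (R \<subseteq> S))"
  proof (rule sum.cong)
    fix S :: "'n set"
    show "(\<Prod>i\<in>S. 1) * (\<Prod>i\<in>UNIV - S. if i \<in> R then 0 else - 1 :: real) =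
        (- 1) ^ card (- S) * of_bool (R \<subseteq> S)"
    proof (cases "R \<subseteq> S")
      case True
      then have "(\<Prod>i\<in>UNIV - S. if i \<in> R then 0 else - 1 :: real) = (\<Prod>i\<in>- S. - 1)"
        by (intro prod.cong) auto
      then show ?thesis using True by simp
    next
      case False
      then have "\<exists>i\<in>UNIV - S. (if i \<in> R then 0 else - 1 :: real) = 0" by auto
      then have "(\<Prod>i\<in>UNIV - S. if i \<in> R then 0 else - 1 :: real) = 0" by (intro prod_zero) auto
      then show ?thesis using False by simp
    qed
  qed simp
  also have "(\<Prod>i\<in>UNIV. 1 + (if i \<in> R then 0 else - 1 :: real)) = of_bool (R = UNIV)"
  proof (cases "R = UNIV")
    case False
    then have "\<exists>i\<in>UNIV. 1 + (if i \<in> R then 0 else - 1 :: real) = 0" by auto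
    then have "(\<Prod>i\<in>UNIV. 1 + (if i \<in> R then 0 else - 1 :: real)) = 0" by (intro prod_zero) auto
    then show ?thesis using False by simp
  qed simp
  finally show ?thesis by simp
qed

lemma permutes_UNIV_iff_surj: "j permutes UNIV \<longleftrightarrow> surj j" for j :: "'n::finite \<Rightarrow> 'n"
  using permutes_surj by (auto intro!: bij_imp_permutes bijI finite_UNIV_surj_inj)

text \<open>At the indicator vector of \<open>S\<close> the monomial of \<open>j\<close> is 1 if
  \<open>range j \<subseteq> S\<close> and 0 otherwise. The alternating sum over \<open>S\<close>
  therefore keeps exactly the surjective index maps, which are the permutations.\<close>

lemma polarization:
  fixes a :: "('n::finite \<Rightarrow> 'n) \<Rightarrow> real"
  shows "(\<Sum>S\<in>UNIV. (- 1) ^ card (- S) * (\<Sum>j\<in>UNIV. a j * (\<Prod>k\<in>UNIV. of_bool (j k \<in> S))))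
    = (\<Sum>j | j permutes UNIV. a j)"
proof -
  have prod: "(\<Prod>k\<in>UNIV. of_bool (j k \<in> S)) = (of_bool (range j \<subseteq> S) :: real)" for j :: "'n \<Rightarrow> 'n" and S
  proof (cases "range j \<subseteq> S")
    case False
    then have "\<exists>k\<in>UNIV. of_bool (j k \<in> S) = (0::real)" by auto
    then have "(\<Prod>k\<in>UNIV. of_bool (j k \<in> S)) = (0::real)" by (intro prod_zero) auto
    then show ?thesis using False by simp
  qed (auto intro!: prod.neutral)
  have "(\<Sum>S\<in>UNIV. (- 1) ^ card (- S) * (\<Sum>j\<in>UNIV. a j * (\<Prod>k\<in>UNIV. of_bool (j k \<in> S))))
      = (\<Sum>S\<in>UNIV. \<Sum>j\<in>UNIV. a j * ((- 1) ^ card (- S) * of_bool (range j \<subseteq> S)))"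
    unfolding prod sum_distrib_left by (simp only: ac_simps)
  also have "\<dots> = (\<Sum>j\<in>UNIV. a j * (\<Sum>S\<in>UNIV. (- 1) ^ card (- S) * of_bool (range j \<subseteq> S)))"
    unfolding sum_distrib_left by (rule sum.swap)
  also have "\<dots> = (\<Sum>j\<in>UNIV. if j permutes UNIV then a j else 0)"
    unfolding sum_signed_of_bool_subset permutes_UNIV_iff_surj by (intro sum.cong) auto
  also have "\<dots> = (\<Sum>j | j permutes UNIV. a j)"
    by (simp add: sum.If_cases)
  finally show ?thesis .
qed

text \<open>The polarized form of the determinant, normalised to be \<open>det X\<close> when all
  matrices equal \<open>X\<close>.\<close>

definition mixed_disc :: "('n::finite \<Rightarrow> real^'n^'n) \<Rightarrow> real" where
  "mixed_disc B = (\<Sum>q | q permutes UNIV. det (\<chi> k. B (q k) $ k)) / fact CARD('n)"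

lemma det_sum_scaleR_rows:
  fixes B :: "'n::finite \<Rightarrow> real^'n^'n"
  shows "det (\<Sum>i\<in>UNIV. t i *\<^sub>R B i) = (\<Sum>j\<in>UNIV. det (\<chi> k. B (j k) $ k) * (\<Prod>k\<in>UNIV. t (j k)))"
proof -
  have "(\<Sum>i\<in>UNIV. t i *\<^sub>R B i) = (\<chi> k. \<Sum>i\<in>UNIV. t i *s (B i $ k))"
    by (simp add: vec_eq_iff)
  then have "det (\<Sum>i\<in>UNIV. t i *\<^sub>R B i) = (\<Sum>j\<in>UNIV. det (\<chi> k. t (j k) *s (B (j k) $ k)))"
    by (simp add: det_linear_rows_sum)
  then show ?thesis by (simp add: det_rows_mul mult.commute)
qed

text \<open>Reduces integrability of the mixed discriminant to that of determinants of sums, whose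
  integrals are volumes.\<close>

lemma mixed_disc_polarization:
  fixes B :: "'n::finite \<Rightarrow> real^'n^'n"
  shows "mixed_disc B =
    (\<Sum>S\<in>UNIV. (- 1) ^ card (- S) * det (\<Sum>i\<in>UNIV. of_bool (i \<in> S) *\<^sub>R B i)) / fact CARD('n)"
  unfolding det_sum_scaleR_rows polarization mixed_disc_def ..

lemma mixed_disc_permute:
  assumes p: "p permutes UNIV"
  shows "mixed_disc (B \<circ> p) = mixed_disc B"
proof -
  have "(\<Sum>q | q permutes UNIV. det (\<chi> k. B (p (q k)) $ k)) = (\<Sum>q | q permutes UNIV. det (\<chi> k. B (q k) $ k))"
    using setum_permutations_compose_left[OF p, of "\<lambda>q. det (\<chi> k. B (q k) $ k)"]
    by (simp add: o_def)
  then show ?thesis by (simp add: mixed_disc_def o_def)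
qed

text \<open>Precomposing \<open>j\<close> with a permutation only rearranges the row expansion of
  the determinant and leaves the monomial unchanged. Averaging the expansion over all permutations
  thus turns its coefficients into mixed discriminants.\<close>

lemma det_sum_eq_mixed_disc:
  fixes B :: "'n::finite \<Rightarrow> real^'n^'n"
  shows "det (\<Sum>i\<in>UNIV. t i *\<^sub>R B i) = (\<Sum>j\<in>UNIV. mixed_disc (B \<circ> j) * (\<Prod>k\<in>UNIV. t (j k)))"
proof -
  define d where "d j = det (\<chi> k. B (j k) $ k) * (\<Prod>k\<in>UNIV. t (j k))" for j :: "'n \<Rightarrow> 'n"
  have q: "(\<Sum>j\<in>UNIV. det (\<chi> k. B (j (q k)) $ k) * (\<Prod>k\<in>UNIV. t (j k))) = sum d UNIV"
    if "q permutes UNIV" for q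
  proof -
    have bij: "bij q" using that by (rule permutes_bij)
    have "bij_betw (\<lambda>j :: 'n \<Rightarrow> 'n. j \<circ> q) UNIV UNIV"
      by (rule bij_betw_byWitness[where f' = "\<lambda>j. j \<circ> inv q"])
        (use bij in \<open>auto simp: fun_eq_iff bij_is_inj bij_is_surj surj_f_inv_f\<close>)
    then have "sum d UNIV = (\<Sum>j\<in>UNIV. d (j \<circ> q))"
      by (rule sum.reindex_bij_betw[symmetric])
    moreover have "(\<Prod>k\<in>UNIV. t (j (q k))) = (\<Prod>k\<in>UNIV. t (j k))" for j
      using bij by (rule prod.reindex_bij_betw)
    ultimately show ?thesis by (simp add: d_def)
  qed
  have "(\<Sum>j\<in>UNIV. mixed_disc (B \<circ> j) * (\<Prod>k\<in>UNIV. t (j k))) =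
    (\<Sum>j\<in>UNIV. \<Sum>q | q permutes UNIV. det (\<chi> k. B (j (q k)) $ k) * (\<Prod>k\<in>UNIV. t (j k))) / fact CARD('n)"
    by (simp add: mixed_disc_def sum_divide_distrib sum_distrib_right)
  also have "\<dots> = (\<Sum>q | q permutes (UNIV::'n set). sum d UNIV) / fact CARD('n)"
    by (subst sum.swap) (simp add: q)
  also have "\<dots> = sum d UNIV"
    by (simp add: card_permutations[OF refl])
  finally show ?thesis by (simp add: det_sum_scaleR_rows d_def)
qed

section \<open>Positive semidefinite matrices, and sign and monotonicity of the mixed
  discriminant\<close>

definition psd :: "real^'n^'n \<Rightarrow> bool" where
  "psd A \<longleftrightarrow> transpose A = A \<and> (\<forall>x. 0 \<le> x \<bullet> (A *v x))"

definition outer :: "real^'n \<Rightarrow> real^'n^'n" where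
  "outer v = (\<chi> i j. v $ i * v $ j)"

lemma outer_mult_vec: "outer v *v x = (v \<bullet> x) *\<^sub>R v"
  by (simp add: vec_eq_iff outer_def matrix_vector_mult_def inner_vec_def sum_distrib_left sum_distrib_right ac_simps)

lemma transpose_outer [simp]: "transpose (outer v) = outer v"
  by (simp add: vec_eq_iff transpose_def outer_def mult.commute)

lemma psd_outer: "psd (outer v)"
  by (simp add: psd_def outer_mult_vec inner_commute[of _ v])

text \<open>With zero diagonal entry, the form at \<open>s *\<^sub>R axis k 1 + axis j 1\<close> is
  affine in \<open>s\<close> with slope twice \<open>A $ k $ j\<close>. A nonzero slope would make
  it negative; the \<open>s\<close> chosen below yields -1.\<close>

lemma psd_diag_zero:
  assumes A: "psd A" and z: "A $ k $ k = 0"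
  shows "A $ k $ j = 0"
proof (rule ccontr)
  assume nz: "A $ k $ j \<noteq> 0"
  define s where "s = - (A $ j $ j + 1) / (2 * A $ k $ j)"
  define x where "x = s *\<^sub>R axis k 1 + axis j (1::real)"
  have sym: "A $ j $ k = A $ k $ j"
    using A unfolding psd_def by (metis transpose_def vec_lambda_beta)
  have col: "(A *v axis l 1) $ i = A $ i $ l" for i l
    by (simp add: matrix_vector_mult_basis column_def)
  have "x \<bullet> (A *v x) = 2 * s * A $ k $ j + A $ j $ j"
    using z sym by (simp add: x_def matrix_vector_right_distrib matrix_vector_mult_scaleR inner_add_left inner_add_right
        inner_axis' inner_axis col algebra_simps)
  also have "\<dots> = - 1" using nz by (simp add: s_def field_simps)
  finally show False using A by (metis psd_def not_one_le_zero neg_0_le_iff_le)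
qed

text \<open>Subtracting the rank one form through the \<open>k\<close>-th row completes the square in the \<open>k\<close>-th coordinate.\<close>

lemma psd_sum_outer_aux:
  fixes A :: "real^'n^'n::finite"
  assumes "finite T" "psd A" "\<And>i j. i \<notin> T \<Longrightarrow> A $ i $ j = 0"
  shows "\<exists>v. A = (\<Sum>m\<in>T. outer (v m))"
  using assms
proof (induction T arbitrary: A rule: finite_induct)
  case empty
  then show ?case by (simp add: vec_eq_iff)
next
  case (insert k T)
  note A = \<open>psd A\<close>
  have sym: "A $ i $ j = A $ j $ i" for i j
    using A unfolding psd_def by (metis transpose_def vec_lambda_beta)
  have diag: "0 \<le> A $ k $ k"
  proof -
    have "0 \<le> axis k 1 \<bullet> (A *v axis k 1)" using A by (simp add: psd_def)
    then show ?thesis by (simp add: inner_axis' matrix_vector_mult_basis column_def)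
  qed
  show ?case
  proof (cases "A $ k $ k = 0")
    case True
    \<comment> \<open>The whole \<open>k\<close>-th row vanishes, so the induction hypothesis
      applies to \<open>A\<close> itself and the summand for \<open>k\<close> is zero.\<close>
    then have "A $ i $ j = 0" if "i \<notin> T" for i j
      using that insert.prems psd_diag_zero[OF A True] by (cases "i = k") auto
    then obtain v where "A = (\<Sum>m\<in>T. outer (v m))" using insert.IH A by blast
    moreover have "outer (0 :: real^'n) = 0" by (simp add: outer_def vec_eq_iff)
    ultimately have "A = (\<Sum>m\<in>insert k T. outer ((v(k := 0)) m))"
      using insert.hyps by (simp add: sum.insert) (intro sum.cong; auto)
    then show ?thesis by blast
  next
    case False
    define a where "a = A $ k $ k"
    have a: "a > 0" using diag False by (simp add: a_def)
    \<comment> \<open>Dividing by the square root of the diagonal entry makes the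
      \<open>k\<close>-th rows of \<open>outer u\<close> and \<open>A\<close> agree.\<close>
    define u where "u = (1 / sqrt a) *\<^sub>R (A $ k)"
    have u: "outer u $ i $ j = A $ k $ i * A $ k $ j / a" for i j
      using a by (simp add: outer_def u_def) 
    have "psd (A - outer u)"
      unfolding psd_def
    proof (intro conjI allI)
      show "transpose (A - outer u) = A - outer u"
        by (simp add: vec_eq_iff transpose_def u sym mult.commute)
      fix x
      \<comment> \<open>This \<open>c\<close> minimises the form of \<open>A\<close> along the line
        through \<open>x\<close> in direction \<open>axis k 1\<close>; the minimum is the form of
        \<open>A - outer u\<close> at \<open>x\<close>.\<close>
      define c where "c = (A $ k \<bullet> x) / a"
      have Ax: "(A *v x) $ k = A $ k \<bullet> x"
        by (simp add: matrix_vector_mul_component)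
      have xA: "x \<bullet> (A *v axis k 1) = A $ k \<bullet> x"
        by (simp add: matrix_vector_mult_basis column_def inner_vec_def sym[of _ k] mult.commute)
      have kk: "(A *v axis k 1) $ k = a"
        by (simp add: matrix_vector_mult_basis column_def a_def)
      have ux: "(u \<bullet> x) * (u \<bullet> x) = (A $ k \<bullet> x)\<^sup>2 / a"
        using a by (simp add: u_def power2_eq_square)
      have "0 \<le> (x - c *\<^sub>R axis k 1) \<bullet> (A *v (x - c *\<^sub>R axis k 1))"
        using A by (simp add: psd_def)
      also have "\<dots> = x \<bullet> (A *v x) - 2 * c * (A $ k \<bullet> x) + c\<^sup>2 * a"
        by (simp add: matrix_vector_mult_diff_distrib matrix_vector_mult_scaleR inner_diff_left inner_diff_right
            inner_axis' Ax xA kk algebra_simps power2_eq_square)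
      also have "\<dots> = x \<bullet> (A *v x) - (A $ k \<bullet> x)\<^sup>2 / a"
        using a by (simp add: c_def field_simps power2_eq_square)
      also have "\<dots> = x \<bullet> ((A - outer u) *v x)"
        by (simp add: matrix_vector_mult_diff_rdistrib outer_mult_vec inner_diff_right inner_commute[of x u] ux)
      finally show "0 \<le> x \<bullet> ((A - outer u) *v x)" .
    qed
    moreover have "(A - outer u) $ i $ j = 0" if "i \<notin> T" for i j
    proof (cases "i = k")
      case True
      then show ?thesis using a by (simp add: u a_def[symmetric])
    next
      case False
      then have "A $ i $ l = 0" for l using that insert.prems by simp
      then show ?thesis by (simp add: u sym[of k i])
    qed
    ultimately obtain v where v: "A - outer u = (\<Sum>m\<in>T. outer (v m))"
      using insert.IH by blast
    have "(\<Sum>m\<in>T. outer (v m)) = (\<Sum>m\<in>T. outer ((v(k := u)) m))"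
      using insert.hyps by (intro sum.cong) auto
    then have "A = (\<Sum>m\<in>insert k T. outer ((v(k := u)) m))"
      using insert.hyps v by (simp add: algebra_simps)
    then show ?thesis by blast
  qed
qed

lemma psd_sum_outer:
  fixes A :: "real^'n^'n::finite"
  assumes "psd A"
  obtains v :: "'n \<Rightarrow> real^'n" where "A = (\<Sum>m\<in>UNIV. outer (v m))"
  using psd_sum_outer_aux[of UNIV A] assms by auto

text \<open>Each row is a multiple of some \<open>w i\<close>, so every term is a signed product of
  coordinates times \<open>det (\<chi> i. w i)\<close>. The signed products add up to the Leibniz
  formula of the transposed matrix, whence the square.\<close>

lemma mixed_disc_outer:
  fixes w :: "'n::finite \<Rightarrow> real^'n"
  shows "mixed_disc (\<lambda>i. outer (w i)) = (det (\<chi> i. w i))\<^sup>2 / fact CARD('n)"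
proof -
  have "det (\<chi> k. outer (w (q k)) $ k) = of_int (sign q) * (\<Prod>k\<in>UNIV. w (q k) $ k) * det (\<chi> i. w i)"
    if q: "q permutes UNIV" for q
  proof -
    have "(\<chi> k. outer (w (q k)) $ k) = (\<chi> k. w (q k) $ k *s w (q k))"
      by (simp add: vec_eq_iff outer_def)
    then have "det (\<chi> k. outer (w (q k)) $ k) = (\<Prod>k\<in>UNIV. w (q k) $ k) * det (\<chi> k. w (q k))"
      by (simp add: det_rows_mul)
    moreover have "det (\<chi> k. w (q k)) = of_int (sign q) * det (\<chi> i. w i)"
      using det_permute_rows[OF q, of "\<chi> i. w i"] by simp
    ultimately show ?thesis by simp
  qed
  then have "mixed_disc (\<lambda>i. outer (w i)) =
    (\<Sum>q | q permutes UNIV. of_int (sign q) * (\<Prod>k\<in>UNIV. w (q k) $ k) * det (\<chi> i. w i)) / fact CARD('n)"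
    unfolding mixed_disc_def by (intro arg_cong2[of _ _ _ _ "(/)"] sum.cong) auto
  also have "\<dots> = det (transpose (\<chi> i. w i)) * det (\<chi> i. w i) / fact CARD('n)"
    by (simp add: det_def transpose_def sum_distrib_right)
  finally show ?thesis by (simp add: det_transpose power2_eq_square)
qed

text \<open>Multilinearity in the rows. Replacing the choice function by \<open>g \<circ> q\<close>
  lets it depend on the matrix rather than on the row, so that one choice serves all permutations
  \<open>q\<close>.\<close>

lemma mixed_disc_sum_outer:
  fixes v :: "'n::finite \<Rightarrow> 'n \<Rightarrow> real^'n"
  shows "mixed_disc (\<lambda>i. \<Sum>m\<in>UNIV. outer (v i m)) = (\<Sum>g\<in>UNIV. mixed_disc (\<lambda>i. outer (v i (g i))))"
proof -
  have "det (\<chi> k. (\<Sum>m\<in>UNIV. outer (v (q k) m)) $ k) = (\<Sum>g\<in>UNIV. det (\<chi> k. outer (v (q k) (g (q k))) $ k))"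
    if q: "q permutes UNIV" for q
  proof -
    have "det (\<chi> k. (\<Sum>m\<in>UNIV. outer (v (q k) m)) $ k) = (\<Sum>f\<in>UNIV. det (\<chi> k. outer (v (q k) (f k)) $ k))"
      using det_linear_rows_sum[of UNIV "\<lambda>k m. outer (v (q k) m) $ k"] by simp
    also have "\<dots> = (\<Sum>g\<in>UNIV. det (\<chi> k. outer (v (q k) ((g \<circ> q) k)) $ k))"
    proof (rule sum.reindex_bij_betw[symmetric])
      show "bij_betw (\<lambda>g :: 'n \<Rightarrow> 'n. g \<circ> q) UNIV UNIV"
        by (rule bij_betw_byWitness[where f' = "\<lambda>j. j \<circ> inv q"])
          (use permutes_bij[OF q] in \<open>auto simp: fun_eq_iff bij_is_inj bij_is_surj surj_f_inv_f\<close>)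
    qed
    finally show ?thesis by simp
  qed
  then have "mixed_disc (\<lambda>i. \<Sum>m\<in>UNIV. outer (v i m)) =
      (\<Sum>q | q permutes UNIV. \<Sum>g\<in>UNIV. det (\<chi> k. outer (v (q k) (g (q k))) $ k)) / fact CARD('n)"
    unfolding mixed_disc_def by (intro arg_cong2[of _ _ _ _ "(/)"] sum.cong) auto
  also have "\<dots> = (\<Sum>g\<in>UNIV. mixed_disc (\<lambda>i. outer (v i (g i))))"
    unfolding mixed_disc_def by (subst sum.swap) (simp add: sum_divide_distrib)
  finally show ?thesis .
qed

text \<open>Splitting each matrix into rank one forms leaves a sum of squared determinants.\<close>

lemma mixed_disc_nonneg:
  fixes B :: "'n::finite \<Rightarrow> real^'n^'n"
  assumes "\<And>i. psd (B i)"
  shows "0 \<le> mixed_disc B"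
proof -
  have "\<exists>v :: 'n \<Rightarrow> real^'n. B i = (\<Sum>m\<in>UNIV. outer (v m))" for i
    using psd_sum_outer[OF assms] by metis
  then obtain v :: "'n \<Rightarrow> 'n \<Rightarrow> real^'n" where "\<And>i. B i = (\<Sum>m\<in>UNIV. outer (v i m))"
    by metis
  then have "B = (\<lambda>i. \<Sum>m\<in>UNIV. outer (v i m))" by auto
  then show ?thesis by (simp add: mixed_disc_sum_outer mixed_disc_outer sum_nonneg)
qed

text \<open>In each term the \<open>i\<close>-th matrix contributes exactly one row, and the
  determinant is additive in that row.\<close>

lemma mixed_disc_add:
  fixes B :: "'n::finite \<Rightarrow> real^'n^'n"
  shows "mixed_disc (B(i := X + Y)) = mixed_disc (B(i := X)) + mixed_disc (B(i := Y))"
proof -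
  have rows: "det (\<chi> k. (B(i := X + Y)) (q k) $ k) = det (\<chi> k. (B(i := X)) (q k) $ k) + det (\<chi> k. (B(i := Y)) (q k) $ k)"
    if q: "q permutes UNIV" for q
  proof -
    obtain l where l: "q l = i" using permutes_surj[OF q] by (metis surjD)
    have l': "q k = i \<longleftrightarrow> k = l" for k using permutes_inj[OF q] l by (metis injD)
    have "(\<chi> k. (B(i := Z)) (q k) $ k) = (\<chi> k. if k = l then Z $ k else B (q k) $ k)" for Z
      by (simp add: vec_eq_iff l')
    then show ?thesis
      using det_row_add[of l "\<lambda>k. X $ k" "\<lambda>k. Y $ k" "\<lambda>k. B (q k) $ k"] by (simp cong: if_cong)
  qed
  show ?thesis
    unfolding mixed_disc_def add_divide_distrib[symmetric] sum.distrib[symmetric]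
    by (intro arg_cong2[of _ _ _ _ "(/)"] sum.cong refl rows) simp
qed

text \<open>Exchange the matrices one at a time: by additivity each exchange adds a mixed
  discriminant of semidefinite matrices, one of which is the difference
  \<open>B k - C k\<close>.\<close>

lemma mixed_disc_mono:
  fixes B C :: "'n::finite \<Rightarrow> real^'n^'n"
  assumes C: "\<And>i. psd (C i)" and B: "\<And>i. psd (B i)" and BC: "\<And>i. psd (B i - C i)"
  shows "mixed_disc C \<le> mixed_disc B"
proof -
  have "mixed_disc C \<le> mixed_disc (\<lambda>i. if i \<in> T then B i else C i)" if "finite T" for T
    using that
  proof (induction T rule: finite_induct)
    case (insert k T)
    define E where "E = (\<lambda>i. if i \<in> T then B i else C i)"
    have "0 \<le> mixed_disc (E(k := B k - C k))"
      by (rule mixed_disc_nonneg) (auto simp: E_def B C BC)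
    moreover have "E(k := C k) = E" using insert.hyps by (auto simp: E_def)
    moreover have "E(k := B k) = (\<lambda>i. if i \<in> insert k T then B i else C i)" by (auto simp: E_def)
    ultimately show ?case
      using insert.IH mixed_disc_add[of E k "C k" "B k - C k"] by (simp add: E_def)
  qed simp
  from this[of UNIV] show ?thesis by simp
qed

section \<open>Potentials of convex bodies\<close>

text \<open>The effective domain of the convex conjugate of \<open>\<phi>\<close>.\<close>

definition lower_slopes :: "('a::real_inner \<Rightarrow> real) \<Rightarrow> 'a set" where
  "lower_slopes \<phi> = {a. \<exists>C. \<forall>x. x \<bullet> a - C \<le> \<phi> x}"

text \<open>\<open>G\<close> and \<open>H\<close> are the gradient and the Hessian of
  \<open>\<phi>\<close>. Strict positivity of \<open>H\<close> makes \<open>G\<close> injective; the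
  last two conditions determine the range of \<open>G\<close> up to boundary points of
  \<open>A\<close>.\<close>

definition potential ::
    "(real^'n) set \<Rightarrow> (real^'n \<Rightarrow> real) \<Rightarrow> (real^'n \<Rightarrow> real^'n) \<Rightarrow> (real^'n \<Rightarrow> real^'n^'n) \<Rightarrow> bool" where
  "potential A \<phi> G H \<longleftrightarrow>
     (\<forall>x. (\<phi> has_derivative (\<lambda>h. G x \<bullet> h)) (at x)) \<and>
     (\<forall>x. (G has_derivative (*v) (H x)) (at x)) \<and>
     (\<forall>x. transpose (H x) = H x) \<and> (\<forall>x h. h \<noteq> 0 \<longrightarrow> 0 < h \<bullet> (H x *v h)) \<and>
     (\<forall>x. G x \<in> A) \<and> A \<subseteq> closure (lower_slopes \<phi>)"

lemma
  fixes f :: "nat \<Rightarrow> 'b::banach"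
  assumes f: "\<And>k. norm (f k) \<le> B * (1/2) ^ Suc k"
  shows summable_geometric_half: "summable f"
    and norm_suminf_tail_half: "norm ((\<Sum>k<n. f k) - suminf f) \<le> B * (1/2) ^ n"
proof -
  have geo: "(\<lambda>k. B * (1/2) ^ Suc (k + n)) sums (B * (1/2) ^ n)" for n
  proof -
    have "(\<lambda>k. B * (1/2) ^ n * (1/2) ^ Suc k) sums (B * (1/2) ^ n * 1)"
      by (intro sums_mult power_half_series)
    moreover have "B * (1/2) ^ n * (1/2) ^ Suc k = B * (1/2) ^ Suc (k + n)" for k
      by (simp only: power_add power_Suc mult.assoc mult.commute mult.left_commute)
    ultimately show ?thesis by (simp only: mult_1_right)
  qed
  have le: "norm (f (k + n)) \<le> B * (1/2) ^ Suc (k + n)" for k n by (rule f)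
  show summ: "summable f"
    by (rule summable_comparison_test'[OF sums_summable[OF geo[of 0]], of 0]) (use f in simp)
  have "norm (\<Sum>k. f (k + n)) \<le> (\<Sum>k. B * (1/2) ^ Suc (k + n))"
    using le sums_summable[OF geo] by (rule norm_suminf_le)
  also have "\<dots> = B * (1/2) ^ n"
    using geo by (rule sums_unique[symmetric])
  finally show "norm ((\<Sum>k<n. f k) - suminf f) \<le> B * (1/2) ^ n"
    using suminf_split_initial_segment[OF summ, of n] by (simp add: norm_minus_commute)
qed

text \<open>The gradient of \<open>x \<mapsto> ln (\<Sum>k. (1/2) ^ Suc k * exp (x \<bullet> a k))\<close> is the mean of the points \<open>a k\<close>
  for weights depending on \<open>x\<close>, and its Hessian is their covariance.\<close>

locale point_sequence =
  fixes a :: "nat \<Rightarrow> real^'n::finite" and R :: real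
  assumes norm_a: "norm (a k) \<le> R"
begin

definition weight :: "real^'n \<Rightarrow> nat \<Rightarrow> real" where
  "weight x k = (1/2) ^ Suc k * exp (x \<bullet> a k)"

definition wsum :: "real^'n \<Rightarrow> (nat \<Rightarrow> 'b::real_normed_vector) \<Rightarrow> 'b" where
  "wsum x c = (\<Sum>k. weight x k *\<^sub>R c k)"

definition mean :: "real^'n \<Rightarrow> (nat \<Rightarrow> 'b::real_normed_vector) \<Rightarrow> 'b" where
  "mean x c = wsum x c /\<^sub>R wsum x (\<lambda>_. 1)"

lemma R_nonneg: "0 \<le> R"
  using norm_a[of 0] norm_ge_zero by (rule order_trans[rotated])

lemma weight_pos: "0 < weight x k"
  by (simp add: weight_def)

lemma abs_inner_a: "\<bar>x \<bullet> a k\<bar> \<le> norm x * R"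
  using Cauchy_Schwarz_ineq2[of x "a k"] norm_a[of k] by (meson mult_left_mono norm_ge_zero order_trans)

lemma weight_bounds:
  assumes "norm x \<le> \<rho>"
  shows "weight x k \<le> exp (\<rho> * R) * (1/2) ^ Suc k" "exp (- (\<rho> * R)) * (1/2) ^ Suc k \<le> weight x k"
proof -
  have "\<bar>x \<bullet> a k\<bar> \<le> \<rho> * R"
    using abs_inner_a[of x k] mult_right_mono[OF assms R_nonneg] by linarith
  then show "weight x k \<le> exp (\<rho> * R) * (1/2) ^ Suc k" "exp (- (\<rho> * R)) * (1/2) ^ Suc k \<le> weight x k"
    unfolding weight_def by (auto simp: mult.commute)
qed

lemma norm_weight_scaleR:
  assumes "norm x \<le> \<rho>" "\<And>k. norm (c k) \<le> M"
  shows "norm (weight x k *\<^sub>R c k) \<le> (exp (\<rho> * R) * M) * (1/2) ^ Suc k"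
proof -
  have "norm (weight x k *\<^sub>R c k) = weight x k * norm (c k)"
    using weight_pos[of x k] by simp
  also have "\<dots> \<le> (exp (\<rho> * R) * (1/2) ^ Suc k) * M"
    using weight_bounds[OF assms(1)] assms(2) weight_pos by (intro mult_mono) auto
  finally show ?thesis by (simp add: mult_ac)
qed

lemma summable_wsum:
  fixes c :: "nat \<Rightarrow> 'b::banach"
  assumes "bounded (range c)"
  shows "summable (\<lambda>k. weight x k *\<^sub>R c k)"
proof -
  obtain M where "\<And>k. norm (c k) \<le> M" using assms unfolding bounded_iff by auto
  from norm_weight_scaleR[OF order_refl this] show ?thesis by (rule summable_geometric_half)
qed

lemma wsum_bounded_linear:
  fixes c :: "nat \<Rightarrow> 'b::banach" and f :: "'b \<Rightarrow> 'c::banach"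
  assumes "bounded_linear f" "bounded (range c)"
  shows "f (wsum x c) = wsum x (\<lambda>k. f (c k))"
  using bounded_linear.suminf[OF assms(1) summable_wsum[OF assms(2)]]
  by (simp add: wsum_def linear_simps(5)[OF assms(1)])

lemma wsum_add:
  fixes c d :: "nat \<Rightarrow> 'b::banach"
  assumes "bounded (range c)" "bounded (range d)"
  shows "wsum x (\<lambda>k. c k + d k) = wsum x c + wsum x d"
  using suminf_add[OF summable_wsum[OF assms(1)] summable_wsum[OF assms(2)], of x x]
  by (simp add: wsum_def scaleR_add_right)

lemma wsum_const_pos: "0 < wsum x (\<lambda>_. 1 :: real)"
  unfolding wsum_def using summable_wsum[of "\<lambda>_. 1 :: real" x] weight_pos
  by (intro suminf_pos) auto

text \<open>Differentiation term by term: on a ball around 0 containing \<open>x\<close>, the tails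
  of the differentiated series are bounded by those of one geometric series, uniformly up to the
  factor \<open>norm h\<close>.\<close>

lemma has_derivative_wsum:
  fixes c :: "nat \<Rightarrow> 'b::banach"
  assumes "bounded (range c)"
  shows "((\<lambda>x. wsum x c) has_derivative (\<lambda>h. wsum x (\<lambda>k. (h \<bullet> a k) *\<^sub>R c k))) (at x)"
proof -
  define S where "S = ball (0 :: real^'n) (norm x + 1)"
  define \<rho> where "\<rho> = norm x + 1"
  obtain M where M: "\<And>k. norm (c k) \<le> M" using assms unfolding bounded_iff by auto
  have M0: "M \<ge> 0" using M[of 0] norm_ge_zero by (rule order_trans[rotated])
  have "open S" "x \<in> S" "convex S" by (auto simp: S_def)
  have sums: "(\<lambda>k. weight y k *\<^sub>R c k) sums wsum y c" for y
    unfolding wsum_def using summable_wsum[OF assms] by (rule summable_sums)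
  have "\<exists>g. \<forall>y\<in>S. (\<lambda>k. weight y k *\<^sub>R c k) sums (g y) \<and>
      (g has_derivative (\<lambda>h. wsum y (\<lambda>k. (h \<bullet> a k) *\<^sub>R c k))) (at y within S)"
  proof (rule has_derivative_series[OF \<open>convex S\<close> _ _ \<open>x \<in> S\<close> sums])
    show "((\<lambda>y. weight y k *\<^sub>R c k) has_derivative (\<lambda>h. (weight y k * (h \<bullet> a k)) *\<^sub>R c k)) (at y within S)"
      for k y
      unfolding weight_def by (auto intro!: derivative_eq_intros)
    fix e :: real assume e: "e > 0"
    define B where "B = exp (\<rho> * R) * (R * M)"
    have "(\<lambda>n. B * (1/2) ^ n) \<longlonglongrightarrow> B * 0"
      by (intro tendsto_intros) auto
    then have "\<forall>\<^sub>F n in sequentially. B * (1/2) ^ n < e"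
      using e by (intro order_tendstoD) auto
    then show "\<forall>\<^sub>F n in sequentially. \<forall>y\<in>S. \<forall>h. norm ((\<Sum>i<n. (weight y i * (h \<bullet> a i)) *\<^sub>R c i) -
        wsum y (\<lambda>k. (h \<bullet> a k) *\<^sub>R c k)) \<le> e * norm h"
    proof (rule eventually_mono, intro ballI allI)
      fix n y h assume n: "B * (1/2) ^ n < e" and y: "y \<in> S"
      have "norm ((h \<bullet> a k) *\<^sub>R c k) \<le> (norm h * R) * M" for k
        using abs_inner_a[of h k] M[of k] M0 R_nonneg by (simp add: mult_mono)
      moreover have "norm y \<le> \<rho>" using y by (simp add: S_def \<rho>_def)
      ultimately have "norm (weight y k *\<^sub>R (h \<bullet> a k) *\<^sub>R c k) \<le> (exp (\<rho> * R) * (norm h * R * M)) * (1/2) ^ Suc k" for k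
        by (intro norm_weight_scaleR) auto
      from norm_suminf_tail_half[OF this, of n]
      have "norm ((\<Sum>i<n. (weight y i * (h \<bullet> a i)) *\<^sub>R c i) - wsum y (\<lambda>k. (h \<bullet> a k) *\<^sub>R c k))
          \<le> B * (1/2) ^ n * norm h"
        by (simp add: wsum_def B_def mult_ac)
      also have "\<dots> \<le> e * norm h" using n by (intro mult_right_mono) auto
      finally show "norm ((\<Sum>i<n. (weight y i * (h \<bullet> a i)) *\<^sub>R c i) - wsum y (\<lambda>k. (h \<bullet> a k) *\<^sub>R c k))
          \<le> e * norm h" .
    qed
  qed
  then obtain g where g: "\<And>y. y \<in> S \<Longrightarrow> (\<lambda>k. weight y k *\<^sub>R c k) sums (g y)"
    and der: "(g has_derivative (\<lambda>h. wsum x (\<lambda>k. (h \<bullet> a k) *\<^sub>R c k))) (at x within S)"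
    using \<open>x \<in> S\<close> by blast
  have eq: "g y = wsum y c" if "y \<in> S" for y
    using g[OF that] sums by (rule sums_unique2)
  have "(g has_derivative (\<lambda>h. wsum x (\<lambda>k. (h \<bullet> a k) *\<^sub>R c k))) (at x)"
    using der by (simp only: at_within_open[OF \<open>x \<in> S\<close> \<open>open S\<close>])
  then show ?thesis
    using \<open>open S\<close> \<open>x \<in> S\<close> eq by (rule has_derivative_transform_within_open)
qed

lemma mean_add:
  fixes c d :: "nat \<Rightarrow> 'b::banach"
  assumes "bounded (range c)" "bounded (range d)"
  shows "mean x (\<lambda>k. c k + d k) = mean x c + mean x d"
  by (simp add: mean_def wsum_add[OF assms] scaleR_add_right)

lemma mean_bounded_linear:
  fixes c :: "nat \<Rightarrow> 'b::banach" and f :: "'b \<Rightarrow> 'c::banach"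
  assumes "bounded_linear f" "bounded (range c)"
  shows "f (mean x c) = mean x (\<lambda>k. f (c k))"
  by (simp add: mean_def wsum_bounded_linear[OF assms, symmetric] linear_simps(5)[OF assms(1)])

lemma mean_const: "mean x (\<lambda>_. r :: real) = r"
proof -
  have "bounded_linear (\<lambda>y :: real. r * y)" by (rule bounded_linear_mult_right)
  from wsum_bounded_linear[OF this, of "\<lambda>_. 1" x] show ?thesis
    using wsum_const_pos[of x] by (simp add: mean_def field_simps)
qed

lemma mean_mono:
  fixes c d :: "nat \<Rightarrow> real"
  assumes "bounded (range c)" "bounded (range d)" "\<And>k. c k \<le> d k"
  shows "mean x c \<le> mean x d"
proof -
  have "wsum x c \<le> wsum x d"
    unfolding wsum_def using assms weight_pos
    by (intro suminf_le summable_wsum scaleR_left_mono) (auto intro: less_imp_le)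
  then show ?thesis
    using wsum_const_pos[of x] by (simp add: mean_def)
qed

lemma bounded_a: "bounded (range a)"
  unfolding bounded_iff using norm_a by auto

lemma bounded_inner_a: "bounded (range (\<lambda>k. h \<bullet> a k))"
  unfolding bounded_iff using abs_inner_a[of h] by auto

lemma bounded_scaleR_a: "bounded (range (\<lambda>k. (h \<bullet> a k) *\<^sub>R a k))"
proof -
  have "norm ((h \<bullet> a k) *\<^sub>R a k) \<le> (norm h * R) * R" for k
    using abs_inner_a[of h k] norm_a[of k] R_nonneg by (simp add: mult_mono)
  then show ?thesis unfolding bounded_iff by auto
qed

section \<open>The logarithmic potential with its gradient and Hessian\<close>

definition pot :: "real^'n \<Rightarrow> real" where
  "pot x = ln (wsum x (\<lambda>_. 1))"

definition grad :: "real^'n \<Rightarrow> real^'n" where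
  "grad x = mean x a"

definition hess :: "real^'n \<Rightarrow> real^'n^'n" where
  "hess x = matrix (\<lambda>h. mean x (\<lambda>k. (h \<bullet> a k) *\<^sub>R a k) - (h \<bullet> grad x) *\<^sub>R grad x)"

lemma inner_grad: "h \<bullet> grad x = mean x (\<lambda>k. h \<bullet> a k)"
  unfolding grad_def by (rule mean_bounded_linear[OF bounded_linear_inner_right bounded_a])

lemma has_derivative_const_wsum:
  "((\<lambda>x. wsum x (\<lambda>_. 1 :: real)) has_derivative (\<lambda>h. wsum x (\<lambda>k. h \<bullet> a k))) (at x)"
  using has_derivative_wsum[of "\<lambda>_. 1 :: real" x] by simp

lemma has_derivative_pot: "(pot has_derivative (\<lambda>h. grad x \<bullet> h)) (at x)"
proof -
  have "(pot has_derivative (\<lambda>h. wsum x (\<lambda>k. h \<bullet> a k) * inverse (wsum x (\<lambda>_. 1)))) (at x)"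
    unfolding pot_def
    by (rule has_derivative_eq_rhs[OF has_derivative_ln[OF wsum_const_pos has_derivative_const_wsum]])
      (simp add: divide_inverse)
  then show ?thesis
    by (simp add: inner_commute[of "grad x"] inner_grad mean_def mult.commute)
qed

lemma has_derivative_grad_aux:
  "(grad has_derivative (\<lambda>h. mean x (\<lambda>k. (h \<bullet> a k) *\<^sub>R a k) - (h \<bullet> grad x) *\<^sub>R grad x)) (at x)"
proof -
  let ?Z = "wsum x (\<lambda>_. 1 :: real)"
  have Z: "?Z \<noteq> 0" using wsum_const_pos[of x] by simp
  have "((\<lambda>x. inverse (wsum x (\<lambda>_. 1 :: real)) *\<^sub>R wsum x a) has_derivative
      (\<lambda>h. inverse ?Z *\<^sub>R wsum x (\<lambda>k. (h \<bullet> a k) *\<^sub>R a k) +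
        (- (inverse ?Z * wsum x (\<lambda>k. h \<bullet> a k) * inverse ?Z)) *\<^sub>R wsum x a)) (at x)"
    by (rule has_derivative_scaleR[OF Deriv.has_derivative_inverse[OF Z has_derivative_const_wsum]
          has_derivative_wsum[OF bounded_a]])
  moreover have "(\<lambda>x. inverse (wsum x (\<lambda>_. 1 :: real)) *\<^sub>R wsum x a) = grad"
    by (simp add: fun_eq_iff grad_def mean_def)
  moreover have "inverse ?Z *\<^sub>R wsum x (\<lambda>k. (h \<bullet> a k) *\<^sub>R a k) +
        (- (inverse ?Z * wsum x (\<lambda>k. h \<bullet> a k) * inverse ?Z)) *\<^sub>R wsum x a
      = mean x (\<lambda>k. (h \<bullet> a k) *\<^sub>R a k) - (h \<bullet> grad x) *\<^sub>R grad x" for h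
    by (simp add: inner_grad) (simp add: grad_def mean_def)
  ultimately show ?thesis by simp
qed

lemma hess_mult: "hess x *v h = mean x (\<lambda>k. (h \<bullet> a k) *\<^sub>R a k) - (h \<bullet> grad x) *\<^sub>R grad x"
  unfolding hess_def using has_derivative_linear[OF has_derivative_grad_aux[of x]]
  by (intro matrix_works) (simp add: linear_matrix_vector_mul_eq)

lemma has_derivative_grad: "(grad has_derivative (*v) (hess x)) (at x)"
  using has_derivative_grad_aux[of x] by (simp add: hess_mult[abs_def])

lemma transpose_hess: "transpose (hess x) = hess x"
proof -
  have "hess x $ i $ j = mean x (\<lambda>k. a k $ i * a k $ j) - grad x $ i * grad x $ j" for i j
  proof -
    have "mean x (\<lambda>k. (axis j 1 \<bullet> a k) *\<^sub>R a k) $ i = mean x (\<lambda>k. ((axis j 1 \<bullet> a k) *\<^sub>R a k) $ i)"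
      by (rule mean_bounded_linear[OF bounded_linear_vec_nth bounded_scaleR_a])
    then show ?thesis by (simp add: hess_def matrix_def inner_axis' mult.commute)
  qed
  then show ?thesis by (simp add: vec_eq_iff transpose_def mult.commute)
qed

lemma bounded_dev: "bounded (range (\<lambda>k. (h \<bullet> (a k - y))\<^sup>2))"
proof -
  have "norm ((h \<bullet> (a k - y))\<^sup>2) \<le> (norm h * (R + norm y))\<^sup>2" for k
  proof -
    have "norm (a k - y) \<le> R + norm y" using norm_triangle_ineq4[of "a k" y] norm_a[of k] by linarith
    then have "\<bar>h \<bullet> (a k - y)\<bar> \<le> norm h * (R + norm y)"
      using Cauchy_Schwarz_ineq2[of h "a k - y"] by (meson mult_left_mono norm_ge_zero order_trans)
    from power_mono[OF this abs_ge_zero, of 2] show ?thesis by simp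
  qed
  then show ?thesis unfolding bounded_iff by auto
qed

text \<open>The identity between second moment minus squared mean and variance, for the values
  \<open>h \<bullet> a k\<close>.\<close>

lemma hess_quadratic: "h \<bullet> (hess x *v h) = mean x (\<lambda>k. (h \<bullet> (a k - grad x))\<^sup>2)"
proof -
  define m where "m = h \<bullet> grad x"
  have b1: "bounded (range (\<lambda>k. (h \<bullet> a k)\<^sup>2))" using bounded_dev[of h 0] by simp
  have b2: "bounded (range (\<lambda>k. - 2 * m * (h \<bullet> a k)))"
    using bounded_scaleR_comp[OF bounded_inner_a, of "- 2 * m" h] by simp
  have b3: "bounded (range (\<lambda>k::nat. m\<^sup>2))" by (simp add: image_constant_conv)
  have "mean x (\<lambda>k. (h \<bullet> (a k - grad x))\<^sup>2) = mean x (\<lambda>k. (h \<bullet> a k)\<^sup>2 + (- 2 * m * (h \<bullet> a k) + m\<^sup>2))"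
    by (rule arg_cong[where f = "mean x"]) (auto simp: m_def inner_diff_right power2_eq_square algebra_simps)
  also have "\<dots> = mean x (\<lambda>k. (h \<bullet> a k)\<^sup>2) + (mean x (\<lambda>k. - 2 * m * (h \<bullet> a k)) + mean x (\<lambda>_. m\<^sup>2))"
    by (subst mean_add[OF b1 bounded_plus_comp[OF b2 b3]]) (simp only: mean_add[OF b2 b3])
  also have "mean x (\<lambda>k. - 2 * m * (h \<bullet> a k)) = - 2 * m * m"
    using mean_bounded_linear[OF bounded_linear_mult_right[of "- 2 * m"] bounded_inner_a[of h], of x]
    by (simp only: m_def inner_grad)
  also have "mean x (\<lambda>k. (h \<bullet> a k)\<^sup>2) = h \<bullet> mean x (\<lambda>k. (h \<bullet> a k) *\<^sub>R a k)"
    using mean_bounded_linear[OF bounded_linear_inner_right[of h] bounded_scaleR_a[of h], of x]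
    by (simp add: power2_eq_square)
  finally show ?thesis
    by (simp add: hess_mult inner_diff_right mean_const m_def power2_eq_square)
qed

text \<open>A zero variance would put all points \<open>a k\<close>, and hence their closure, into
  one hyperplane orthogonal to \<open>h\<close>, which has empty interior.\<close>

lemma hess_pos:
  assumes A: "A \<subseteq> closure (range a)" "interior A \<noteq> {}" and h: "h \<noteq> 0"
  shows "0 < h \<bullet> (hess x *v h)"
proof -
  define c where "c = (\<lambda>k. (h \<bullet> (a k - grad x))\<^sup>2)"
  have "\<exists>k. c k \<noteq> 0"
  proof (rule ccontr)
    assume "\<not> ?thesis"
    then have "range a \<subseteq> {y. h \<bullet> y = h \<bullet> grad x}" by (auto simp: c_def inner_diff_right)
    then have "closure (range a) \<subseteq> {y. h \<bullet> y = h \<bullet> grad x}"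
      by (intro closure_minimal closed_hyperplane)
    then have "interior A \<subseteq> interior {y. h \<bullet> y = h \<bullet> grad x}"
      using A(1) by (intro interior_mono) auto
    then show False using A(2) h by (simp add: interior_hyperplane)
  qed
  then obtain k where k: "c k \<noteq> 0" by blast
  have "0 < wsum x c"
    unfolding wsum_def
  proof (rule suminf_pos2)
    show "summable (\<lambda>k. weight x k *\<^sub>R c k)" using bounded_dev unfolding c_def by (rule summable_wsum)
    show "0 \<le> weight x i *\<^sub>R c i" for i using weight_pos[of x i] by (simp add: c_def)
    show "0 < weight x k *\<^sub>R c k" using weight_pos[of x k] k by (simp add: c_def)
  qed
  then show ?thesis
    unfolding hess_quadratic using wsum_const_pos[of x] by (simp add: mean_def c_def)
qed

text \<open>A weighted mean of points of a closed convex set cannot be strictly separated from that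
  set.\<close>

lemma grad_in:
  assumes "convex A" "closed A" "range a \<subseteq> A"
  shows "grad x \<in> A"
proof (rule ccontr)
  assume "grad x \<notin> A"
  then obtain u b where u: "u \<bullet> grad x < b" "\<forall>y\<in>A. u \<bullet> y > b"
    using separating_hyperplane_closed_point[OF assms(1,2)] by blast
  have "mean x (\<lambda>_. b) \<le> mean x (\<lambda>k. u \<bullet> a k)"
  proof (rule mean_mono[OF _ bounded_inner_a])
    show "b \<le> u \<bullet> a k" for k
      using u(2) assms(3) by (meson less_imp_le rangeI subsetD)
  qed (simp add: image_constant_conv)
  then show False using u(1) by (simp add: inner_grad mean_const)
qed

text \<open>Keeping only the \<open>k\<close>-th summand inside the logarithm leaves an affine
  minorant with slope \<open>a k\<close>.\<close>

lemma range_subset_lower_slopes: "range a \<subseteq> lower_slopes pot"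
proof
  fix y assume "y \<in> range a"
  then obtain k where k: "y = a k" by blast
  have "x \<bullet> a k - (- ln ((1/2) ^ Suc k)) \<le> pot x" for x
  proof -
    have "weight x k \<le> wsum x (\<lambda>_. 1 :: real)"
      using sum_le_suminf[OF summable_wsum[of "\<lambda>_. 1 :: real" x], of "{k}"] weight_pos
      by (simp add: wsum_def less_imp_le)
    then have "ln (weight x k) \<le> pot x"
      unfolding pot_def using weight_pos[of x k] wsum_const_pos[of x] by simp
    moreover have "ln (weight x k) = x \<bullet> a k + ln ((1/2) ^ Suc k)"
      unfolding weight_def by (subst ln_mult) auto
    ultimately show ?thesis by simp
  qed
  then show "y \<in> lower_slopes pot" unfolding k lower_slopes_def by blast
qed

text \<open>Only the points 0 and \<open>w\<close> are kept in the variance. On the unit ball their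
  weights are at least \<open>exp (- R) / 4\<close>, while the total weight is at most
  \<open>exp R\<close>.\<close>

lemma hess_lower:
  assumes a: "a 0 = 0" "a 1 = w" and x: "norm x \<le> 1"
  shows "exp (- 2 * R) / 8 * (w \<bullet> h)\<^sup>2 \<le> h \<bullet> (hess x *v h)"
proof -
  define c where "c = (\<lambda>k. (h \<bullet> (a k - grad x))\<^sup>2)"
  define s where "s = h \<bullet> grad x"
  define t where "t = w \<bullet> h"
  let ?Z = "wsum x (\<lambda>_. 1 :: real)"
  have c01: "c 0 = s\<^sup>2" "c 1 = (t - s)\<^sup>2"
    using a by (simp_all add: c_def s_def t_def inner_diff_right inner_commute)
  have "?Z \<le> (\<Sum>k. exp R * (1/2) ^ Suc k)"
    unfolding wsum_def using weight_bounds(1)[OF x] summable_wsum[of "\<lambda>_. 1 :: real" x]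
      summable_mult[OF sums_summable[OF power_half_series], of "exp R"]
    by (intro suminf_le) (auto simp: bounded_iff)
  also have "\<dots> = exp R"
    using sums_mult[OF power_half_series, of "exp R"] by (simp add: sums_iff)
  finally have Z: "?Z \<le> exp R" .
  \<comment> \<open>Wherever the mean \<open>s\<close> lies, it cannot be close to both 0 and
    \<open>t\<close>.\<close>
  have "t\<^sup>2 / 2 \<le> s\<^sup>2 + (t - s)\<^sup>2"
    using zero_le_power2[of "t - 2 * s"] by (simp add: power2_eq_square algebra_simps)
  then have "exp (- R) / 4 * (t\<^sup>2 / 2) \<le> exp (- R) / 4 * (s\<^sup>2 + (t - s)\<^sup>2)"
    by (rule mult_left_mono) simp
  then have "exp (- R) * t\<^sup>2 / 8 \<le> exp (- R) / 4 * (s\<^sup>2 + (t - s)\<^sup>2)"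
    by simp
  also have "\<dots> \<le> weight x 0 * c 0 + weight x 1 * c 1"
  proof -
    have "exp (- R) / 4 * s\<^sup>2 \<le> weight x 0 * c 0"
    proof -
      have "exp (- R) / 4 \<le> weight x 0"
        using weight_bounds(2)[OF x, of 0] weight_pos[of x 0] by simp
      then show ?thesis unfolding c01 by (intro mult_right_mono) auto
    qed
    moreover have "exp (- R) / 4 * (t - s)\<^sup>2 \<le> weight x 1 * c 1"
      unfolding c01 using weight_bounds(2)[OF x, of 1]
      by (intro mult_right_mono) auto
    ultimately show ?thesis by (simp add: distrib_left)
  qed
  also have "\<dots> \<le> wsum x c"
  proof -
    have "(\<Sum>k\<in>{0,1}. weight x k *\<^sub>R c k) \<le> (\<Sum>k. weight x k *\<^sub>R c k)"
    proof (rule sum_le_suminf)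
      show "summable (\<lambda>k. weight x k *\<^sub>R c k)" using bounded_dev unfolding c_def by (rule summable_wsum)
      show "0 \<le> weight x i *\<^sub>R c i" for i using weight_pos[of x i] by (simp add: c_def)
    qed simp
    then show ?thesis by (simp add: wsum_def)
  qed
  finally have W: "exp (- R) * t\<^sup>2 / 8 \<le> wsum x c" .
  have "exp (- 2 * R) = exp (- R) / exp R"
    using exp_diff[of "- R" R] by simp
  then have "exp (- 2 * R) / 8 * t\<^sup>2 = (exp (- R) * t\<^sup>2 / 8) / exp R"
    by simp
  also have "\<dots> \<le> (exp (- R) * t\<^sup>2 / 8) / ?Z"
    using Z wsum_const_pos[of x] by (intro divide_left_mono) auto
  also have "\<dots> \<le> wsum x c / ?Z"
    using W wsum_const_pos[of x] by (intro divide_right_mono) auto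
  also have "\<dots> = mean x c"
    by (simp add: mean_def divide_inverse mult.commute)
  also have "\<dots> = h \<bullet> (hess x *v h)"
    by (simp only: hess_quadratic c_def)
  finally show ?thesis by (simp only: t_def)
qed

end

lemma potential_exists:
  fixes A :: "(real^'n::finite) set"
  assumes A: "convex_body A" and "0 \<in> A" "w \<in> A" and R: "A \<subseteq> cball 0 R"
  obtains \<phi> G H where "potential A \<phi> G H"
    and "\<And>x. norm x \<le> 1 \<Longrightarrow> psd (H x - (exp (- 2 * R) / 8) *\<^sub>R outer w)"
proof -
  have "compact A" "convex A" "interior A \<noteq> {}" using A by (auto simp: convex_body_def)
  obtain T where T: "countable T" "T \<subseteq> A" "A \<subseteq> closure T" using separable[of A] by blast
  define T' where "T' = insert 0 T"
  have T': "countable T'" "T' \<noteq> {}" using T(1) by (auto simp: T'_def)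
  \<comment> \<open>The first two places are reserved for the points 0 and \<open>w\<close> of
    \<open>hess_lower\<close>; the dense set is enumerated from index 2 on. Adding 0 to it ensures
    that there is something to enumerate.\<close>
  define a where "a = (\<lambda>k. if k = 0 then 0 else if k = 1 then w else from_nat_into T' (k - 2))"
  have aA: "range a \<subseteq> A"
  proof
    fix y assume "y \<in> range a"
    moreover have "from_nat_into T' k \<in> A" for k
      using from_nat_into[OF T'(2), of k] T(2) \<open>0 \<in> A\<close> by (auto simp: T'_def)
    ultimately show "y \<in> A" using \<open>0 \<in> A\<close> \<open>w \<in> A\<close> by (auto simp: a_def)
  qed
  have "T' \<subseteq> range a"
  proof
    fix y assume "y \<in> T'"
    then obtain k where "y = from_nat_into T' k" using from_nat_into_surj[OF T'(1)] by metis
    then have "y = a (k + 2)" by (simp add: a_def)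
    then show "y \<in> range a" by blast
  qed
  then have dense: "A \<subseteq> closure (range a)"
    using T(3) closure_mono[of T "range a"] by (auto simp: T'_def)
  interpret point_sequence a R
  proof
    show "norm (a k) \<le> R" for k
      using aA R by (metis in_mono mem_cball_0 rangeI)
  qed
  have hess_psd: "psd (hess x - (exp (- 2 * R) / 8) *\<^sub>R outer w)" if "norm x \<le> 1" for x
    unfolding psd_def
  proof (intro conjI allI)
    have "transpose (hess x - r *\<^sub>R outer w) = transpose (hess x) - r *\<^sub>R transpose (outer w)" for r
      by (simp add: transpose_def vec_eq_iff)
    then show "transpose (hess x - (exp (- 2 * R) / 8) *\<^sub>R outer w) = hess x - (exp (- 2 * R) / 8) *\<^sub>R outer w"
      by (simp only: transpose_hess transpose_outer)
    fix h
    have "h \<bullet> ((hess x - (exp (- 2 * R) / 8) *\<^sub>R outer w) *v h) =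
        h \<bullet> (hess x *v h) - exp (- 2 * R) / 8 * (w \<bullet> h)\<^sup>2"
      by (simp add: matrix_vector_mult_diff_rdistrib scaleR_matrix_vector_assoc[symmetric] outer_mult_vec
          inner_diff_right inner_commute[of h w] power2_eq_square)
    then show "0 \<le> h \<bullet> ((hess x - (exp (- 2 * R) / 8) *\<^sub>R outer w) *v h)"
      using hess_lower[OF _ _ that, of w h] by (simp add: a_def)
  qed
  have "potential A pot grad hess"
    unfolding potential_def
  proof (intro conjI allI impI)
    show "A \<subseteq> closure (lower_slopes pot)"
      using dense closure_mono[OF range_subset_lower_slopes] by blast
    show "grad x \<in> A" for x
      using \<open>convex A\<close> compact_imp_closed[OF \<open>compact A\<close>] aA by (rule grad_in)
  qed (use has_derivative_pot has_derivative_grad transpose_hess hess_pos[OF dense \<open>interior A \<noteq> {}\<close>] in auto)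
  then show ?thesis using that hess_psd by blast
qed

section \<open>Mixed volumes as integrals of mixed discriminants\<close>

text \<open>If all slopes near \<open>y\<close> admit affine minorants,
  \<open>\<phi> x - x \<bullet> y\<close> grows at least linearly. It therefore has a global
  minimum, at which the gradient of \<open>\<phi>\<close> is \<open>y\<close>.\<close>

lemma grad_attains_slope:
  fixes \<phi> :: "real^'n::finite \<Rightarrow> real"
  assumes der: "\<And>x. (\<phi> has_derivative (\<lambda>h. G x \<bullet> h)) (at x)"
    and y: "y \<in> interior (lower_slopes \<phi>)"
  shows "y \<in> range G"
proof -
  obtain e where e: "e > 0" "cball y e \<subseteq> lower_slopes \<phi>"
    using y by (meson mem_interior_cball)
  \<comment> \<open>The minorants with slopes \<open>y + e *\<^sub>R axis j 1\<close> and
    \<open>y - e *\<^sub>R axis j 1\<close> together control the absolute value of the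
    \<open>j\<close>-th coordinate.\<close>
  have "\<exists>C. \<forall>x. e * \<bar>x $ j\<bar> - C \<le> \<phi> x - x \<bullet> y" for j
  proof -
    have "y + e *\<^sub>R axis j 1 \<in> cball y e" "y - e *\<^sub>R axis j 1 \<in> cball y e"
      using e(1) by (auto simp: dist_norm)
    then obtain C D where CD: "\<And>x. x \<bullet> (y + e *\<^sub>R axis j 1) - C \<le> \<phi> x"
        "\<And>x. x \<bullet> (y - e *\<^sub>R axis j 1) - D \<le> \<phi> x"
      using e(2) unfolding lower_slopes_def by blast
    have "e * \<bar>x $ j\<bar> - max C D \<le> \<phi> x - x \<bullet> y" for x
      using CD[of x] by (auto simp: inner_add_right inner_diff_right inner_axis abs_if max_def)
    then show ?thesis by blast
  qed
  then obtain C where C: "\<And>j x. e * \<bar>x $ j\<bar> - C j \<le> \<phi> x - x \<bullet> y" by metis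
  define n where "n = real CARD('n)"
  have n: "n > 0" by (simp add: n_def)
  define \<psi> where "\<psi> = (\<lambda>x. \<phi> x - x \<bullet> y)"
  \<comment> \<open>Chosen so that \<open>\<psi>\<close> is at least \<open>\<psi> 0\<close> outside
    radius \<open>r\<close>. A minimum over the ball of radius \<open>\<bar>r\<bar>\<close>, which
    contains 0, is then global.\<close>
  define r where "r = (n * \<psi> 0 + (\<Sum>j\<in>UNIV. C j)) / e"
  have low: "e * norm x - (\<Sum>j\<in>UNIV. C j) \<le> n * \<psi> x" for x
  proof -
    have "(\<Sum>j\<in>UNIV. e * \<bar>x $ j\<bar> - C j) \<le> (\<Sum>j\<in>(UNIV::'n set). \<psi> x)"
      unfolding \<psi>_def by (intro sum_mono C)
    moreover have "e * norm x \<le> e * (\<Sum>j\<in>UNIV. \<bar>x $ j\<bar>)"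
      using e(1) norm_le_l1_cart[of x] by simp
    ultimately show ?thesis by (simp add: sum_subtractf sum_distrib_left n_def)
  qed
  have far: "\<psi> 0 \<le> \<psi> x" if "r \<le> norm x" for x
  proof -
    have "n * \<psi> 0 + (\<Sum>j\<in>UNIV. C j) \<le> e * norm x"
      using that e(1) by (simp add: r_def field_simps)
    then have "n * \<psi> 0 \<le> n * \<psi> x" using low[of x] by linarith
    then show ?thesis using n by simp
  qed
  have der_\<psi>: "(\<psi> has_derivative (\<lambda>h. G x \<bullet> h - h \<bullet> y)) (at x)" for x
    unfolding \<psi>_def by (intro has_derivative_diff der has_derivative_inner_left has_derivative_ident)
  have "continuous_on (cball 0 \<bar>r\<bar>) \<psi>"
    using has_derivative_continuous[OF der_\<psi>] by (intro continuous_at_imp_continuous_on) auto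
  then have "\<exists>x\<in>cball 0 \<bar>r\<bar>. \<forall>z\<in>cball 0 \<bar>r\<bar>. \<psi> x \<le> \<psi> z"
    by (intro continuous_attains_inf) auto
  then obtain x where x: "\<And>z. z \<in> cball 0 \<bar>r\<bar> \<Longrightarrow> \<psi> x \<le> \<psi> z" by blast
  have "\<psi> x \<le> \<psi> z" for z
  proof (cases "norm z \<le> \<bar>r\<bar>")
    case False
    then show ?thesis using far[of z] x[of 0] by fastforce
  qed (use x in simp)
  then have "(\<lambda>h. G x \<bullet> h - h \<bullet> y) = (\<lambda>h. 0)"
    by (intro differential_zero_maxmin[OF UNIV_I open_UNIV der_\<psi>]) auto
  then have "(G x - y) \<bullet> h = 0" for h
    by (metis inner_commute inner_diff_left)
  then have "G x = y" by (metis inner_eq_zero_iff right_minus_eq)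
  then show ?thesis by blast
qed

text \<open>Along the segment from \<open>x\<close> to \<open>y\<close> the component of
  \<open>G\<close> in direction \<open>y - x\<close> is strictly increasing.\<close>

lemma inj_if_derivative_pos:
  fixes G :: "real^'n::finite \<Rightarrow> real^'n"
  assumes der: "\<And>x. (G has_derivative (*v) (H x)) (at x)"
    and pos: "\<And>x h. h \<noteq> 0 \<Longrightarrow> 0 < h \<bullet> (H x *v h)"
  shows "inj G"
proof (rule injI, rule ccontr)
  fix x y assume eq: "G x = G y" and "x \<noteq> y"
  define h where "h = y - x"
  have h: "h \<noteq> 0" using \<open>x \<noteq> y\<close> by (simp add: h_def)
  define f where "f = (\<lambda>s :: real. h \<bullet> G (x + s *\<^sub>R h))"
  have der_f: "(f has_real_derivative h \<bullet> (H (x + s *\<^sub>R h) *v h)) (at s)" for s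
  proof -
    have "((\<lambda>s. x + s *\<^sub>R h) has_derivative (\<lambda>t. t *\<^sub>R h)) (at s)"
      by (auto intro!: derivative_eq_intros)
    from has_derivative_compose[OF this der]
    have "(f has_derivative (\<lambda>t. h \<bullet> (H (x + s *\<^sub>R h) *v (t *\<^sub>R h)))) (at s)"
      unfolding f_def by (intro has_derivative_inner_right)
    moreover have "(\<lambda>t. h \<bullet> (H (x + s *\<^sub>R h) *v (t *\<^sub>R h))) = (*) (h \<bullet> (H (x + s *\<^sub>R h) *v h))"
      by (simp add: fun_eq_iff matrix_vector_mult_scaleR)
    ultimately show ?thesis
      unfolding has_field_derivative_def by simp
  qed
  have "f 0 < f 1"
    by (rule DERIV_pos_imp_increasing[of 0 1 f]) (simp, use der_f pos[OF h] in blast)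
  then show False using eq by (simp add: f_def h_def)
qed

section \<open>Volumes of Minkowski sums by transport\<close>

lemma compact_set_sum:
  fixes A :: "'i \<Rightarrow> 'a::real_normed_vector set"
  assumes "\<And>i. i \<in> I \<Longrightarrow> compact (A i)"
  shows "compact (\<Sum>i\<in>I. A i)"
  using assms
proof (induction I rule: infinite_finite_induct)
  case (insert i I)
  then have "compact {x + y | x y. x \<in> A i \<and> y \<in> (\<Sum>i\<in>I. A i)}" by (intro compact_sums) auto
  moreover have "{x + y | x y. x \<in> A i \<and> y \<in> (\<Sum>i\<in>I. A i)} = A i + (\<Sum>i\<in>I. A i)"
    by (auto simp: set_plus_def)
  ultimately show ?case using insert.hyps by simp
qed (simp_all add: set_zero)

lemma mem_sum_scaled_iff:
  fixes A :: "'i::finite \<Rightarrow> 'a::real_vector set"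
  shows "x \<in> (\<Sum>i\<in>UNIV. (\<lambda>x. t i *\<^sub>R x) ` A i) \<longleftrightarrow> (\<exists>y. (\<forall>i. y i \<in> A i) \<and> x = (\<Sum>i\<in>UNIV. t i *\<^sub>R y i))"
    (is "_ \<longleftrightarrow> ?R")
proof -
  have "x \<in> (\<Sum>i\<in>UNIV. (\<lambda>x. t i *\<^sub>R x) ` A i) \<longleftrightarrow> (\<exists>s. x = sum s UNIV \<and> (\<forall>i. s i \<in> (\<lambda>x. t i *\<^sub>R x) ` A i))"
    by (simp add: set_sum_alt)
  also have "\<dots> \<longleftrightarrow> ?R"
  proof
    assume "\<exists>s. x = sum s UNIV \<and> (\<forall>i. s i \<in> (\<lambda>x. t i *\<^sub>R x) ` A i)"
    then obtain s where s: "x = sum s UNIV" "\<forall>i. \<exists>y. y \<in> A i \<and> s i = t i *\<^sub>R y" by blast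
    from choice[OF s(2)] show ?R using s(1) by auto
  qed auto
  finally show ?thesis .
qed

lemma lower_slopes_sum:
  assumes "\<And>i. 0 \<le> t i" "\<And>i. a i \<in> lower_slopes (\<phi> i)"
  shows "(\<Sum>i\<in>UNIV. t i *\<^sub>R a i) \<in> lower_slopes (\<lambda>x. \<Sum>i\<in>(UNIV::'i::finite set). t i * \<phi> i x)"
proof -
  obtain C where C: "\<And>i x. x \<bullet> a i - C i \<le> \<phi> i x"
    using assms(2) unfolding lower_slopes_def mem_Collect_eq by metis
  have "x \<bullet> (\<Sum>i\<in>UNIV. t i *\<^sub>R a i) - (\<Sum>i\<in>UNIV. t i * C i) \<le> (\<Sum>i\<in>UNIV. t i * \<phi> i x)" for x
  proof -
    have "(\<Sum>i\<in>UNIV. t i * (x \<bullet> a i - C i)) \<le> (\<Sum>i\<in>UNIV. t i * \<phi> i x)"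
      using assms(1) C by (intro sum_mono mult_left_mono) auto
    then show ?thesis by (simp add: inner_sum_right right_diff_distrib sum_subtractf)
  qed
  then show ?thesis unfolding lower_slopes_def by blast
qed

text \<open>Averages of affine minorants are affine minorants. Convexity serves to show that the
  closure of this set has no further interior points.\<close>

lemma convex_lower_slopes: "convex (lower_slopes \<phi>)"
proof (rule convexI)
  fix a b and u v :: real
  assume "a \<in> lower_slopes \<phi>" "b \<in> lower_slopes \<phi>" and uv: "0 \<le> u" "0 \<le> v" "u + v = 1"
  then obtain C D where CD: "\<And>x. x \<bullet> a - C \<le> \<phi> x" "\<And>x. x \<bullet> b - D \<le> \<phi> x"
    unfolding lower_slopes_def by blast
  have "x \<bullet> (u *\<^sub>R a + v *\<^sub>R b) - (u * C + v * D) \<le> \<phi> x" for x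
  proof -
    have "u * (x \<bullet> a - C) + v * (x \<bullet> b - D) \<le> u * \<phi> x + v * \<phi> x"
      using CD[of x] uv by (intro add_mono mult_left_mono) auto
    also have "\<dots> = \<phi> x" using uv(3) by (metis distrib_right mult_1)
    finally show ?thesis by (simp add: inner_add_right algebra_simps)
  qed
  then show "u *\<^sub>R a + v *\<^sub>R b \<in> lower_slopes \<phi>" unfolding lower_slopes_def by blast
qed

lemma det_sum_psd_nonneg:
  fixes B :: "'n::finite \<Rightarrow> real^'n^'n"
  assumes "\<And>i. psd (B i)" "\<And>i. 0 \<le> t i"
  shows "0 \<le> det (\<Sum>i\<in>UNIV. t i *\<^sub>R B i)"
  unfolding det_sum_eq_mixed_disc
  using assms by (intro sum_nonneg mult_nonneg_nonneg prod_nonneg mixed_disc_nonneg) auto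

lemma potential_psd: "potential A \<phi> G H \<Longrightarrow> psd (H x)"
  unfolding potential_def psd_def by (metis inner_zero_left less_imp_le order_refl)

text \<open>The gradients of the potentials transport Lebesgue measure with density \<open>det (\<Sum>i. t i *\<^sub>R H i x)\<close>
  onto the Minkowski sum, up to a part of its boundary.\<close>

lemma has_integral_volume_sum:
  fixes A :: "'n::finite \<Rightarrow> (real^'n) set"
  assumes body: "\<And>i. convex_body (A i)" and pot: "\<And>i. potential (A i) (\<phi> i) (G i) (H i)"
    and t: "\<And>i. 0 \<le> t i"
  shows "((\<lambda>x. det (\<Sum>i\<in>UNIV. t i *\<^sub>R H i x)) has_integral
      measure lebesgue (\<Sum>i\<in>UNIV. (\<lambda>x. t i *\<^sub>R x) ` A i)) UNIV"
proof (cases "\<forall>i. t i = 0")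
  \<comment> \<open>Here the combined gradient is constant and not injective, so the case is
    separate: the sum degenerates to a point and both sides are 0.\<close>
  case True
  have "A i \<noteq> {}" for i using body[of i] by (auto simp: convex_body_def)
  then have "\<forall>i. \<exists>z. z \<in> A i" by blast
  then have "\<exists>y. \<forall>i. y i \<in> A i" by (rule choice)
  then obtain y\<^sub>0 where y\<^sub>0: "\<forall>i. y\<^sub>0 i \<in> A i" ..
  have zero: "(\<Sum>i\<in>UNIV. t i *\<^sub>R y i) = 0" for y :: "'n \<Rightarrow> real^'n"
    by (simp add: True[rule_format])
  have "(\<Sum>i\<in>UNIV. (\<lambda>x. t i *\<^sub>R x) ` A i) = {0}"
  proof (intro equalityI subsetI)
    fix x assume "x \<in> (\<Sum>i\<in>UNIV. (\<lambda>x. t i *\<^sub>R x) ` A i)"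
    then obtain y where "x = (\<Sum>i\<in>UNIV. t i *\<^sub>R y i)"
      unfolding mem_sum_scaled_iff by (elim exE conjE)
    then show "x \<in> {0}" by (simp only: zero singleton_iff)
  next
    fix x :: "real^'n" assume "x \<in> {0}"
    then have "x = (\<Sum>i\<in>UNIV. t i *\<^sub>R y\<^sub>0 i)" by (simp only: zero singleton_iff)
    with y\<^sub>0 show "x \<in> (\<Sum>i\<in>UNIV. (\<lambda>x. t i *\<^sub>R x) ` A i)"
      unfolding mem_sum_scaled_iff by (intro exI[of _ y\<^sub>0] conjI)
  qed
  moreover have "det (\<Sum>i\<in>UNIV. t i *\<^sub>R H i x) = 0" for x
    using det_0[where 'a = real and 'n = 'n] by (simp add: True[rule_format])
  ultimately show ?thesis by simp
next
  case False
  then obtain l where l: "t l > 0" using t by (metis less_eq_real_def)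
  define S where "S = (\<Sum>i\<in>UNIV. (\<lambda>x. t i *\<^sub>R x) ` A i)"
  define \<Phi> where "\<Phi> = (\<lambda>x. \<Sum>i\<in>UNIV. t i * \<phi> i x)"
  define g where "g = (\<lambda>x. \<Sum>i\<in>UNIV. t i *\<^sub>R G i x)"
  define D where "D = (\<lambda>x. \<Sum>i\<in>UNIV. t i *\<^sub>R H i x)"
  note potD = pot[unfolded potential_def]
  have mult: "D x *v h = (\<Sum>i\<in>UNIV. t i *\<^sub>R (H i x *v h))" for x h
  proof -
    have "linear (\<lambda>M :: real^'n^'n. M *v h)"
      by (intro linearI) (simp_all add: matrix_vector_mult_add_rdistrib scaleR_matrix_vector_assoc)
    from linear_sum[OF this] show ?thesis by (simp add: D_def scaleR_matrix_vector_assoc)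
  qed
  have der_g: "(g has_derivative (*v) (D x)) (at x)" for x
  proof -
    have "(g has_derivative (\<lambda>h. \<Sum>i\<in>UNIV. t i *\<^sub>R (H i x *v h))) (at x)"
      unfolding g_def using potD by (intro has_derivative_sum has_derivative_scaleR_right) blast
    then show ?thesis by (simp add: mult[abs_def])
  qed
  have pos: "0 < h \<bullet> (D x *v h)" if "h \<noteq> 0" for x h
  proof -
    have nn: "0 \<le> t i * (h \<bullet> (H i x *v h))" for i
      using t potD that by (intro mult_nonneg_nonneg) (auto intro: less_imp_le)
    have "0 < t l * (h \<bullet> (H l x *v h))"
      using l potD that by (intro mult_pos_pos) auto
    also have "\<dots> \<le> (\<Sum>i\<in>UNIV. t i * (h \<bullet> (H i x *v h)))"
      using nn by (intro member_le_sum) auto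
    also have "\<dots> = h \<bullet> (D x *v h)" by (simp add: mult inner_sum_right)
    finally show ?thesis .
  qed
  have inj: "inj g" using der_g pos by (rule inj_if_derivative_pos)
  have der_\<Phi>: "(\<Phi> has_derivative (\<lambda>h. g x \<bullet> h)) (at x)" for x
  proof -
    have "(\<Phi> has_derivative (\<lambda>h. \<Sum>i\<in>UNIV. t i * (G i x \<bullet> h))) (at x)"
      unfolding \<Phi>_def using potD by (intro has_derivative_sum has_derivative_mult_right) blast
    then show ?thesis by (simp add: g_def inner_sum_left)
  qed
  have convA: "convex (A i)" and compA: "compact (A i)" for i using body[of i] by (auto simp: convex_body_def)
  have compS: "compact S"
    unfolding S_def using compA by (intro compact_set_sum compact_scaling)
  have convS: "convex S"
    unfolding S_def using convA by (intro convex_set_sum convex_scaling)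
  have sub: "range g \<subseteq> S"
  proof clarify
    fix x
    show "g x \<in> S"
      unfolding S_def g_def mem_sum_scaled_iff
      by (rule exI[of _ "\<lambda>i. G i x"]) (use potD in blast)
  qed
  have "S \<subseteq> closure (lower_slopes \<Phi>)"
  proof
    fix x assume "x \<in> S"
    then obtain y where y: "\<And>i. y i \<in> A i" "x = (\<Sum>i\<in>UNIV. t i *\<^sub>R y i)"
      unfolding S_def mem_sum_scaled_iff by blast
    have "y i \<in> closure (lower_slopes (\<phi> i))" for i using y(1) potD by blast
    then have "\<exists>s. (\<forall>n. s n \<in> lower_slopes (\<phi> i)) \<and> s \<longlonglongrightarrow> y i" for i
      by (simp add: closure_sequential)
    then obtain s where s: "\<And>i n. s i n \<in> lower_slopes (\<phi> i)" "\<And>i. s i \<longlonglongrightarrow> y i" by metis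
    have "(\<lambda>n. \<Sum>i\<in>UNIV. t i *\<^sub>R s i n) \<longlonglongrightarrow> x"
      unfolding y(2) by (intro tendsto_intros s)
    moreover have "(\<Sum>i\<in>UNIV. t i *\<^sub>R s i n) \<in> lower_slopes \<Phi>" for n
      unfolding \<Phi>_def using t s(1) by (rule lower_slopes_sum)
    ultimately show "x \<in> closure (lower_slopes \<Phi>)"
      unfolding closure_sequential by (intro exI[of _ "\<lambda>n. \<Sum>i\<in>UNIV. t i *\<^sub>R s i n"]) auto
  qed
  \<comment> \<open>A convex set and its closure have the same interior, so interior points of
    \<open>S\<close> are interior slopes of \<open>\<Phi>\<close> and thus values of its
    gradient.\<close>
  then have "interior S \<subseteq> interior (lower_slopes \<Phi>)"
    using interior_mono convex_interior_closure[OF convex_lower_slopes] by metis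
  then have "interior S \<subseteq> range g"
    using grad_attains_slope[OF der_\<Phi>] by blast
  \<comment> \<open>\<open>range g\<close> lies between the interior of \<open>S\<close> and
    \<open>S\<close>, and the frontier of a convex set is negligible.\<close>
  then have "negligible ((S - range g) \<union> (range g - S))"
    using sub compS by (intro negligible_subset[OF negligible_convex_frontier[OF convS]])
      (auto simp: frontier_def compact_imp_closed)
  then have "range g \<in> lmeasurable" "measure lebesgue (range g) = measure lebesgue S"
    using lmeasurable_negligible_symdiff measure_negligible_symdiff lmeasurable_compact[OF compS] by blast+
  with has_integral_det_image[OF der_g inj]
  have "((\<lambda>x. \<bar>det (D x)\<bar>) has_integral measure lebesgue S) UNIV" by simp
  moreover have "\<bar>det (D x)\<bar> = det (D x)" for x
    unfolding D_def using det_sum_psd_nonneg[of "\<lambda>i. H i x" t] potential_psd[OF pot] t by simp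
  ultimately show ?thesis by (simp add: D_def S_def)
qed

section \<open>Existence, uniqueness, bounds and scaling of mixed volumes\<close>

text \<open>The alternating sum of the volume polynomial over 0-1 vectors keeps the coefficients of
  permutations, which all equal \<open>a id\<close> by symmetry. Hence the volumes determine
  \<open>a id\<close>.\<close>

lemma mixed_volume_polarization:
  fixes K :: "'n::finite \<Rightarrow> (real^'n) set"
  assumes "minkowski_coeffs K a"
  shows "fact CARD('n) * a id =
    (\<Sum>S\<in>UNIV. (- 1) ^ card (- S) * measure lebesgue (\<Sum>i\<in>UNIV. (\<lambda>x. of_bool (i \<in> S) *\<^sub>R x) ` K i))"
proof -
  have vol: "measure lebesgue (\<Sum>i\<in>UNIV. (\<lambda>x. of_bool (i \<in> S) *\<^sub>R x) ` K i) =
      (\<Sum>j\<in>UNIV. a j * (\<Prod>k\<in>UNIV. of_bool (j k \<in> S)))" for S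
    using assms unfolding minkowski_coeffs_def by simp
  have "a j = a id" if "j permutes UNIV" for j
    using assms that unfolding minkowski_coeffs_def by (metis id_comp)
  then have "(\<Sum>j | j permutes UNIV. a j) = (\<Sum>j | j permutes (UNIV::'n set). a id)"
    by (intro sum.cong refl) blast
  then show ?thesis unfolding vol polarization by (simp add: card_permutations[OF refl])
qed

text \<open>Polarization gives the uniqueness that the definite description in
  \<open>mixed_volume\<close> requires.\<close>

lemma mixed_volume_eqI:
  fixes K :: "'n::finite \<Rightarrow> (real^'n) set"
  assumes "minkowski_coeffs K a"
  shows "mixed_volume K = a id"
  unfolding mixed_volume_def
proof (rule the_equality)
  show "v = a id" if "\<exists>b. minkowski_coeffs K b \<and> v = b id" for v
    using that mixed_volume_polarization[OF assms] mixed_volume_polarization[of K]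
    by (metis fact_nonzero mult_cancel_left)
qed (use assms in blast)

lemma integrable_mixed_disc:
  fixes A :: "'n::finite \<Rightarrow> (real^'n) set"
  assumes body: "\<And>i. convex_body (A i)" and pot: "\<And>i. potential (A i) (\<phi> i) (G i) (H i)"
  shows "(\<lambda>x. mixed_disc (\<lambda>i. H i x)) integrable_on UNIV"
proof -
  have "((\<lambda>x. \<Sum>S\<in>UNIV. (- 1) ^ card (- S) * det (\<Sum>i\<in>UNIV. of_bool (i \<in> S) *\<^sub>R H i x)) has_integral
    (\<Sum>S\<in>UNIV. (- 1) ^ card (- S) * measure lebesgue (\<Sum>i\<in>UNIV. (\<lambda>x. of_bool (i \<in> S) *\<^sub>R x) ` A i))) UNIV"
    by (intro has_integral_sum has_integral_mult_right has_integral_volume_sum[OF body pot]) auto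
  from has_integral_divide[OF this, of "fact CARD('n)"] show ?thesis
    unfolding mixed_disc_polarization by blast
qed

text \<open>Integrate the expansion of the determinant term by term and compare with the transported
  volume. For bodies with potentials this is the existence part of Minkowski's theorem.\<close>

lemma minkowski_coeffs_integral:
  fixes A :: "'n::finite \<Rightarrow> (real^'n) set"
  assumes body: "\<And>i. convex_body (A i)" and pot: "\<And>i. potential (A i) (\<phi> i) (G i) (H i)"
  shows "minkowski_coeffs A (\<lambda>j. integral UNIV (\<lambda>x. mixed_disc (\<lambda>k. H (j k) x)))"
  unfolding minkowski_coeffs_def
proof (intro conjI allI impI)
  fix j p :: "'n \<Rightarrow> 'n" assume "p permutes UNIV"
  then have "mixed_disc (\<lambda>k. H ((j \<circ> p) k) x) = mixed_disc (\<lambda>k. H (j k) x)" for x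
    using mixed_disc_permute[of p "\<lambda>k. H (j k) x"] by (simp add: o_def)
  then show "integral UNIV (\<lambda>x. mixed_disc (\<lambda>k. H ((j \<circ> p) k) x)) = integral UNIV (\<lambda>x. mixed_disc (\<lambda>k. H (j k) x))"
    by simp
next
  fix t :: "'n \<Rightarrow> real" assume t: "\<forall>i. 0 \<le> t i"
  have int: "((\<lambda>x. \<Sum>j\<in>UNIV. mixed_disc (\<lambda>k. H (j k) x) * (\<Prod>k\<in>UNIV. t (j k))) has_integral
      (\<Sum>j\<in>UNIV. integral UNIV (\<lambda>x. mixed_disc (\<lambda>k. H (j k) x)) * (\<Prod>k\<in>UNIV. t (j k)))) UNIV"
    by (intro has_integral_sum has_integral_mult_left integrable_integral integrable_mixed_disc[OF body pot]) auto
  have eq: "(\<Sum>j\<in>UNIV. mixed_disc (\<lambda>k. H (j k) x) * (\<Prod>k\<in>UNIV. t (j k))) = det (\<Sum>i\<in>UNIV. t i *\<^sub>R H i x)" for x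
    by (simp add: det_sum_eq_mixed_disc o_def)
  have "((\<lambda>x. det (\<Sum>i\<in>UNIV. t i *\<^sub>R H i x)) has_integral
      measure lebesgue (\<Sum>i\<in>UNIV. (\<lambda>x. t i *\<^sub>R x) ` A i)) UNIV"
    using t by (intro has_integral_volume_sum[OF body pot]) auto
  then show "measure lebesgue (\<Sum>i\<in>UNIV. (\<lambda>x. t i *\<^sub>R x) ` A i) =
      (\<Sum>j\<in>UNIV. integral UNIV (\<lambda>x. mixed_disc (\<lambda>k. H (j k) x)) * (\<Prod>k\<in>UNIV. t (j k)))"
    using int[unfolded eq] by (rule has_integral_unique)
qed

text \<open>Only the unit ball is kept in the integral. There each Hessian dominates a multiple of
  \<open>outer (w i)\<close> by a factor depending on \<open>R\<close> alone, and monotonicity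
  reduces to the rank one case.\<close>

lemma mixed_volume_lower_bound:
  fixes A :: "'n::finite \<Rightarrow> (real^'n) set"
  assumes body: "\<And>i. convex_body (A i)" and A: "\<And>i. 0 \<in> A i" "\<And>i. w i \<in> A i" "\<And>i. A i \<subseteq> cball 0 R"
  shows "(exp (- 2 * R) / 8) ^ CARD('n) * (det (\<chi> i. w i))\<^sup>2 / fact CARD('n) * measure lebesgue (cball (0::real^'n) 1)
    \<le> mixed_volume A"
proof -
  define \<kappa> where "\<kappa> = exp (- 2 * R) / 8"
  have \<kappa>: "\<kappa> > 0" by (simp add: \<kappa>_def)
  have "\<exists>\<phi> G H. potential (A i) \<phi> G H \<and> (\<forall>x. norm x \<le> 1 \<longrightarrow> psd (H x - \<kappa> *\<^sub>R outer (w i)))" for i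
    using potential_exists[OF body A(1,2,3), of i] unfolding \<kappa>_def by metis
  then obtain \<phi> G H where pot: "\<And>i. potential (A i) (\<phi> i) (G i) (H i)"
    and H: "\<And>i x. norm x \<le> 1 \<Longrightarrow> psd (H i x - \<kappa> *\<^sub>R outer (w i))" by metis
  define c where "c = \<kappa> ^ CARD('n) * (det (\<chi> i. w i))\<^sup>2 / fact CARD('n)"
  have "((\<lambda>x. c * indicat_real (cball (0::real^'n) 1) x) has_integral c * measure lebesgue (cball (0::real^'n) 1)) UNIV"
    using lmeasurable_iff_has_integral[THEN iffD1, OF lmeasurable_cball] by (rule has_integral_mult_right)
  moreover have "((\<lambda>x. mixed_disc (\<lambda>i. H i x)) has_integral mixed_volume A) UNIV"
    using mixed_volume_eqI[OF minkowski_coeffs_integral[OF body pot]]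
      integrable_integral[OF integrable_mixed_disc[OF body pot]] by simp
  moreover have "c * indicat_real (cball 0 1) x \<le> mixed_disc (\<lambda>i. H i x)" for x
  proof (cases "norm x \<le> 1")
    case True
    \<comment> \<open>The factor is absorbed into the vectors, so that the comparison matrices have
      the form treated in \<open>mixed_disc_outer\<close>.\<close>
    have eq: "\<kappa> *\<^sub>R outer (w i) = outer (sqrt \<kappa> *\<^sub>R w i)" for i
      using \<kappa> by (simp add: outer_def vec_eq_iff)
    have "c = mixed_disc (\<lambda>i. outer (sqrt \<kappa> *\<^sub>R w i))"
    proof -
      have "det (\<chi> i. sqrt \<kappa> *\<^sub>R w i) = sqrt \<kappa> ^ CARD('n) * det (\<chi> i. w i)"
        using det_rows_mul[of "\<lambda>_. sqrt \<kappa>" w] by (simp add: scalar_mult_eq_scaleR)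
      moreover have "(sqrt \<kappa> ^ CARD('n))\<^sup>2 = \<kappa> ^ CARD('n)"
        using \<kappa> by (metis less_imp_le mult.commute power_mult real_sqrt_pow2)
      ultimately show ?thesis by (simp add: mixed_disc_outer c_def power_mult_distrib)
    qed
    also have "\<dots> \<le> mixed_disc (\<lambda>i. H i x)"
      using potential_psd[OF pot] H[OF True] by (intro mixed_disc_mono) (auto simp: psd_outer eq)
    finally show ?thesis using True by simp
  qed (simp add: mixed_disc_nonneg potential_psd[OF pot])
  ultimately have "c * measure lebesgue (cball (0::real^'n) 1) \<le> mixed_volume A"
    by (rule has_integral_le)
  then show ?thesis by (simp add: c_def \<kappa>_def)
qed

lemma minkowski_coeffs_exists:
  fixes A :: "'n::finite \<Rightarrow> (real^'n) set"
  assumes body: "\<And>i. convex_body (A i)" and A: "\<And>i. 0 \<in> A i"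
  obtains a where "minkowski_coeffs A a"
proof -
  have "\<exists>\<phi> G H. potential (A i) \<phi> G H" for i
  proof -
    have "bounded (A i)" using body by (auto simp: convex_body_def compact_imp_bounded)
    then obtain r where "A i \<subseteq> cball 0 r" by (auto simp: bounded_iff subset_iff)
    \<comment> \<open>The distinguished point is taken to be 0 here, since the Hessian bound plays
      no part in mere existence.\<close>
    then show ?thesis using potential_exists[OF body A A] by metis
  qed
  then obtain \<phi> G H where pot: "\<And>i. potential (A i) (\<phi> i) (G i) (H i)" by metis
  show ?thesis by (rule that[OF minkowski_coeffs_integral[OF body pot]])
qed

text \<open>In the polarization formula each of the \<open>2 ^ CARD('n)\<close> partial sums lies in
  the ball of radius \<open>CARD('n) * R\<close>; signs are dropped and the factorial is estimated
  by 1.\<close>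

lemma mixed_volume_upper_bound:
  fixes A :: "'n::finite \<Rightarrow> (real^'n) set" and R :: real
  assumes body: "\<And>i. convex_body (A i)" and A: "\<And>i. 0 \<in> A i" "\<And>i. A i \<subseteq> cball 0 R"
  shows "mixed_volume A \<le> 2 ^ CARD('n) * measure lebesgue (cball (0::real^'n) (CARD('n) * R))"
proof -
  obtain a where a: "minkowski_coeffs A a" by (rule minkowski_coeffs_exists[OF body A(1)])
  define U where "U = (\<lambda>S. \<Sum>i\<in>UNIV. (\<lambda>x. of_bool (i \<in> S) *\<^sub>R x) ` A i)"
  define V where "V = measure lebesgue (cball (0::real^'n) (CARD('n) * R))"
  have "measure lebesgue (U S) \<le> V" for S
    unfolding V_def
  proof (rule measure_mono_fmeasurable)
    show "U S \<subseteq> cball 0 (CARD('n) * R)"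
    proof
      fix x assume "x \<in> U S"
      then obtain y where y: "\<And>i. y i \<in> A i" "x = (\<Sum>i\<in>UNIV. of_bool (i \<in> S) *\<^sub>R y i)"
        unfolding U_def mem_sum_scaled_iff by blast
      have "norm (of_bool (i \<in> S) *\<^sub>R y i) \<le> R" for i
      proof -
        have "norm (y i) \<le> R" using y(1)[of i] A(2)[of i] by auto
        then show ?thesis using order_trans[OF norm_ge_zero] by (cases "i \<in> S") auto
      qed
      then have "norm x \<le> (\<Sum>i\<in>(UNIV::'n set). R)"
        unfolding y(2) by (intro sum_norm_le) auto
      then show "x \<in> cball 0 (CARD('n) * R)" by simp
    qed
    have "compact (U S)"
      unfolding U_def using body by (intro compact_set_sum compact_scaling) (simp add: convex_body_def)
    then show "U S \<in> sets lebesgue" by (simp add: fmeasurableD lmeasurable_compact)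
  qed simp
  then have "(\<Sum>S\<in>UNIV. (- 1) ^ card (- S) * measure lebesgue (U S)) \<le> (\<Sum>S\<in>(UNIV :: 'n set set). V)"
  proof (intro sum_mono)
    fix S
    have "(- 1) ^ card (- S) * measure lebesgue (U S) \<le> \<bar>(- 1) ^ card (- S) * measure lebesgue (U S)\<bar>" by simp
    also have "\<dots> = measure lebesgue (U S)" by (simp add: abs_mult power_abs)
    also assume "\<And>S. measure lebesgue (U S) \<le> V"
    finally show "(- 1) ^ card (- S) * measure lebesgue (U S) \<le> V" .
  qed
  then have "fact CARD('n) * a id \<le> 2 ^ CARD('n) * V"
    unfolding mixed_volume_polarization[OF a] U_def by (simp add: card_UNIV_set)
  moreover have "1 * (2 ^ CARD('n) * V) \<le> fact CARD('n) * (2 ^ CARD('n) * V)"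
    by (intro mult_right_mono fact_ge_1) (simp add: V_def)
  ultimately have "fact CARD('n) * a id \<le> fact CARD('n) * (2 ^ CARD('n) * V)" by linarith
  then have "a id \<le> 2 ^ CARD('n) * V" by (simp add: mult_le_cancel_left_pos)
  then show ?thesis by (simp add: mixed_volume_eqI[OF a] V_def)
qed

text \<open>Substituting \<open>t i * s i\<close> for \<open>t i\<close> in the volume polynomial
  multiplies the coefficient of \<open>j\<close> by the product of the
  \<open>s (j k)\<close>.\<close>

lemma mixed_volume_scale:
  fixes A :: "'n::finite \<Rightarrow> (real^'n) set"
  assumes body: "\<And>i. convex_body (A i)" and A: "\<And>i. 0 \<in> A i" and s: "\<And>i. 0 \<le> s i"
  shows "mixed_volume (\<lambda>i. (\<lambda>x. s i *\<^sub>R x) ` A i) = (\<Prod>i\<in>UNIV. s i) * mixed_volume A"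
proof -
  obtain a where a: "minkowski_coeffs A a" by (rule minkowski_coeffs_exists[OF body A(1)])
  have "minkowski_coeffs (\<lambda>i. (\<lambda>x. s i *\<^sub>R x) ` A i) (\<lambda>j. a j * (\<Prod>k\<in>UNIV. s (j k)))"
    unfolding minkowski_coeffs_def
  proof (intro conjI allI impI)
    fix j p :: "'n \<Rightarrow> 'n" assume p: "p permutes UNIV"
    have "(\<Prod>k\<in>UNIV. s (j (p k))) = (\<Prod>k\<in>UNIV. s (j k))"
      using permutes_bij[OF p] by (rule prod.reindex_bij_betw)
    then show "a (j \<circ> p) * (\<Prod>k\<in>UNIV. s ((j \<circ> p) k)) = a j * (\<Prod>k\<in>UNIV. s (j k))"
      using a p by (simp add: minkowski_coeffs_def)
  next
    fix t :: "'n \<Rightarrow> real" assume t: "\<forall>i. 0 \<le> t i"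
    then have "measure lebesgue (\<Sum>i\<in>UNIV. (\<lambda>x. (t i * s i) *\<^sub>R x) ` A i) =
        (\<Sum>j\<in>UNIV. a j * (\<Prod>k\<in>UNIV. t (j k) * s (j k)))"
      using a s by (simp add: minkowski_coeffs_def)
    then show "measure lebesgue (\<Sum>i\<in>UNIV. (\<lambda>x. t i *\<^sub>R x) ` (\<lambda>x. s i *\<^sub>R x) ` A i) =
        (\<Sum>j\<in>UNIV. a j * (\<Prod>k\<in>UNIV. s (j k)) * (\<Prod>k\<in>UNIV. t (j k)))"
      by (simp add: image_image prod.distrib mult_ac)
  qed
  from mixed_volume_eqI[OF this] mixed_volume_eqI[OF a] show ?thesis by simp
qed

section \<open>Fractional linear maps\<close>

text \<open>The projective map that fixes the origin and sends the hyperplane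
  \<open>x \<bullet> u = k\<close> to infinity.\<close>

definition cut :: "real^'n \<Rightarrow> real \<Rightarrow> real^'n \<Rightarrow> real^'n" where
  "cut u k x = (1 / (k - x \<bullet> u)) *\<^sub>R x"

lemma cut_0 [simp]: "cut u k 0 = 0"
  by (simp add: cut_def)

text \<open>The block matrix is lower triangular with diagonal entries 1 and \<open>k\<close>, hence
  has trivial kernel.\<close>

lemma fractional_linear_map_cut:
  fixes u :: "real^'n::finite"
  assumes "u \<noteq> 0" "k \<noteq> 0"
  shows "fractional_linear_map {x. x \<bullet> u < k} (cut u k)"
proof -
  define A where "A = block_matrix (mat 1) (0 :: real^'n) (- u) k"
  have mult: "(A *v x) $ r = (\<Sum>j\<in>UNIV. A $ r $ Inl j * x $ Inl j) + A $ r $ Inr () * x $ Inr ()" for x r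
    unfolding matrix_vector_mult_def by (simp add: UNIV_Plus_UNIV[symmetric] sum.Plus UNIV_unit o_def)
  have "x = 0" if x: "A *v x = 0" for x
  proof -
    have inl: "x $ Inl i = 0" for i
    proof -
      have "(\<Sum>j\<in>UNIV. A $ Inl i $ Inl j * x $ Inl j) = (\<Sum>j\<in>UNIV. if j = i then x $ Inl j else 0)"
        by (intro sum.cong) (auto simp: A_def block_matrix_def mat_def)
      then show ?thesis
        using x mult[of x "Inl i"] by (simp add: A_def block_matrix_def)
    qed
    have "x $ Inr () = 0"
      using x mult[of x "Inr ()"] assms(2) by (simp add: inl A_def block_matrix_def)
    with inl show "x = 0" unfolding vec_eq_iff by (metis old.unit.exhaust sumE zero_index)
  qed
  then have "invertible A"
    by (simp add: invertible_left_inverse matrix_left_invertible_ker)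
  moreover have "{x. x \<bullet> u < k} = {x. x \<bullet> (- u) + k > 0}" by auto
  moreover have "cut u k x = (1 / (x \<bullet> (- u) + k)) *\<^sub>R (mat 1 *v x + 0)" for x
    by (simp add: cut_def)
  ultimately show ?thesis
    using assms(1) unfolding fractional_linear_map_def A_def
    by (intro exI[of _ "mat 1"] exI[of _ 0] exI[of _ "- u"] exI[of _ k]) simp
qed

text \<open>A combination of two image points is the image of a combination with other weights:
  those are proportional to the old weights divided by the respective denominators.\<close>

lemma convex_cut:
  assumes K: "convex K" and sub: "\<And>x. x \<in> K \<Longrightarrow> x \<bullet> u < k"
  shows "convex (cut u k ` K)"
proof (rule convexI)
  fix x' y' and \<alpha> \<beta> :: real
  assume "x' \<in> cut u k ` K" "y' \<in> cut u k ` K" and ab: "0 \<le> \<alpha>" "0 \<le> \<beta>" "\<alpha> + \<beta> = 1"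
  then obtain x y where xy: "x \<in> K" "y \<in> K" "x' = cut u k x" "y' = cut u k y" by blast
  define p where "p = \<alpha> / (k - x \<bullet> u)"
  define q where "q = \<beta> / (k - y \<bullet> u)"
  have pos: "0 < k - x \<bullet> u" "0 < k - y \<bullet> u" using sub xy(1,2) by simp_all
  have pq: "p * (k - x \<bullet> u) = \<alpha>" "q * (k - y \<bullet> u) = \<beta>" using pos by (simp_all add: p_def q_def)
  have pq0: "0 \<le> p" "0 \<le> q" using pos ab by (simp_all add: p_def q_def)
  have "p + q \<noteq> 0"
  proof
    assume "p + q = 0"
    then have "p = 0" "q = 0" using pq0 by linarith+
    then show False using pq ab(3) by simp
  qed
  then have s: "0 < p + q" using pq0 by linarith
  define z where "z = (p / (p + q)) *\<^sub>R x + (q / (p + q)) *\<^sub>R y"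
  have "z \<in> K" unfolding z_def
    using K xy(1,2) pq0 s by (intro convexD) (auto simp: add_divide_distrib[symmetric])
  moreover have "cut u k z = \<alpha> *\<^sub>R x' + \<beta> *\<^sub>R y'"
  proof -
    have sz: "(p + q) *\<^sub>R z = p *\<^sub>R x + q *\<^sub>R y"
      using s by (simp add: z_def scaleR_add_right)
    have "(p + q) * (k - z \<bullet> u) = (p + q) * k - ((p + q) *\<^sub>R z) \<bullet> u"
      by (simp add: right_diff_distrib)
    also have "\<dots> = p * (k - x \<bullet> u) + q * (k - y \<bullet> u)"
      unfolding sz by (simp add: inner_add_left algebra_simps)
    also have "\<dots> = 1" using pq ab(3) by simp
    finally have "(p + q) * (k - z \<bullet> u) = 1" .
    then have "1 / (k - z \<bullet> u) = p + q"
      by (metis mult_zero_right nonzero_divide_eq_eq zero_neq_one)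
    then have "cut u k z = p *\<^sub>R x + q *\<^sub>R y" by (simp add: cut_def sz)
    then show ?thesis by (simp add: xy(3,4) cut_def p_def q_def)
  qed
  ultimately show "\<alpha> *\<^sub>R x' + \<beta> *\<^sub>R y' \<in> cut u k ` K" by (metis imageI)
qed

lemma convex_body_cut:
  fixes K :: "(real^'n::finite) set"
  assumes K: "compact K" "convex K" "0 \<in> interior K" and sub: "\<And>x. x \<in> K \<Longrightarrow> x \<bullet> u < k"
  shows "convex_body (cut u k ` K)"
  unfolding convex_body_def
proof (intro conjI)
  have "continuous_on K (cut u k)"
    unfolding cut_def using sub by (intro continuous_intros) force
  then show "compact (cut u k ` K)" using K(1) by (rule compact_continuous_image)
  show "convex (cut u k ` K)" using K(2) sub by (rule convex_cut)
  have k: "k > 0" using sub[of 0] K(3) interior_subset by fastforce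
  \<comment> \<open>A right inverse of \<open>cut u k\<close> near 0. Its continuity there shows
    that all small \<open>y\<close> are images of points of \<open>K\<close>.\<close>
  define g where "g = (\<lambda>y. (k / (1 + y \<bullet> u)) *\<^sub>R y)"
  have "isCont g 0" unfolding g_def by (intro continuous_intros) simp
  moreover have "g 0 = 0" by (simp add: g_def)
  ultimately have "(g \<longlongrightarrow> 0) (nhds 0)"
    using tendsto_at_iff_tendsto_nhds isCont_def by metis
  then have 1: "\<forall>\<^sub>F y in nhds 0. g y \<in> interior K"
    using K(3) by (rule topological_tendstoD[OF _ open_interior])
  have "((\<lambda>y. 1 + y \<bullet> u) \<longlongrightarrow> 1 + 0 \<bullet> u) (nhds 0)"
    by (intro tendsto_intros) (simp add: filterlim_ident)
  then have 2: "\<forall>\<^sub>F y in nhds 0. 0 < 1 + y \<bullet> u"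
    by (rule order_tendstoD) simp
  have "\<forall>\<^sub>F y in nhds 0. y \<in> cut u k ` K"
    using 1 2
  proof eventually_elim
    case (elim y)
    have "g y \<bullet> u = k * (y \<bullet> u) / (1 + y \<bullet> u)" by (simp add: g_def)
    then have "k - g y \<bullet> u = k / (1 + y \<bullet> u)"
      using elim(2) by (simp add: field_simps)
    then have "cut u k (g y) = y"
      using elim(2) k by (simp add: cut_def g_def)
    then show ?case using elim(1) interior_subset by (metis image_eqI subsetD)
  qed
  then show "interior (cut u k ` K) \<noteq> {}"
    unfolding eventually_nhds by (metis empty_iff interiorI subsetI)
qed

lemma zero_in_interior_scaleR:
  fixes K :: "'a::euclidean_space set"
  assumes "0 \<in> interior K" "0 < t"
  shows "0 \<in> interior ((\<lambda>x. t *\<^sub>R x) ` K)"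
proof -
  obtain e where e: "e > 0" "ball 0 e \<subseteq> K" using assms(1) by (auto simp: mem_interior)
  have "ball 0 (t * e) \<subseteq> (\<lambda>x. t *\<^sub>R x) ` K"
  proof
    fix x :: 'a assume "x \<in> ball 0 (t * e)"
    then have "(1 / t) *\<^sub>R x \<in> K" using e(2) assms(2) by (auto simp: subset_iff field_simps)
    moreover have "x = t *\<^sub>R (1 / t) *\<^sub>R x" using assms(2) by simp
    ultimately show "x \<in> (\<lambda>x. t *\<^sub>R x) ` K" by blast
  qed
  then show ?thesis using e(1) assms(2) by (metis mem_interior mult_pos_pos)
qed

section \<open>The blow-up at a supporting hyperplane\<close>

text \<open>If the coordinate of \<open>x\<close> at \<open>l\<close> is nonzero, transposing
  \<open>m\<close> and \<open>l\<close> lets the other rows supply all basis directions except that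
  of \<open>l\<close>, which \<open>x\<close> contributes.\<close>

lemma det_replace_row_nonzero:
  fixes x :: "real^'n::finite"
  assumes "x \<noteq> 0" "r \<noteq> 0"
  obtains \<tau> :: "'n \<Rightarrow> 'n" where "det (\<chi> i. if i = m then x else r *\<^sub>R axis (\<tau> i) 1) \<noteq> 0"
proof -
  obtain l where l: "x $ l \<noteq> 0" using assms(1) by (auto simp: vec_eq_iff)
  define \<tau> where "\<tau> = Transposition.transpose m l"
  define A where "A = (\<chi> i. if i = m then x else r *\<^sub>R axis (\<tau> i) 1)"
  have "z = 0" if z: "A *v z = 0" for z
  proof -
    have row: "A $ i \<bullet> z = 0" for i
      using z by (metis matrix_vector_mul_component zero_index)
    have off: "z $ j = 0" if "j \<noteq> l" for j
    proof -
      have "\<tau> j \<noteq> m" "\<tau> (\<tau> j) = j" using that by (auto simp: \<tau>_def Transposition.transpose_def)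
      then show ?thesis using row[of "\<tau> j"] assms(2) by (simp add: A_def inner_axis')
    qed
    have "x \<bullet> z = (\<Sum>j\<in>UNIV. if j = l then x $ j * z $ j else 0)"
      unfolding inner_vec_def by (intro sum.cong) (auto simp: off)
    then have "x $ l * z $ l = 0" using row[of m] by (simp add: A_def)
    then show "z = 0" using l off by (metis mult_eq_0_iff vec_eq_iff zero_index)
  qed
  then have "det A \<noteq> 0"
    by (simp add: invertible_det_nz[symmetric] invertible_left_inverse matrix_left_invertible_ker)
  then show ?thesis using that by (simp add: A_def)
qed

theorem theorem5p1:
  fixes K L :: "'n::finite \<Rightarrow> (real^'n) set"
  assumes "\<And>i. convex_body (K i)" and "\<And>i. 0 \<in> interior (K i)"
    and "\<And>i. convex_body (L i)" and "\<And>i. 0 \<in> interior (L i)"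
    and "\<And>(t :: 'n \<Rightarrow> real) D F.
      (\<And>i. 0 < t i) \<Longrightarrow>
      fractional_linear_map D F \<Longrightarrow>
      (\<And>i. (\<lambda>x. t i *\<^sub>R x) ` K i \<subseteq> D \<and> (\<lambda>x. t i *\<^sub>R x) ` L i \<subseteq> D) \<Longrightarrow>
      mixed_volume (\<lambda>i. F ` (\<lambda>x. t i *\<^sub>R x) ` K i)
        \<le> mixed_volume (\<lambda>i. F ` (\<lambda>x. t i *\<^sub>R x) ` L i)"
  shows "\<forall>i. K i \<subseteq> L i"
proof (rule ccontr)
  assume "\<not> ?thesis"
  then obtain m x where x: "x \<in> K m" "x \<notin> L m" by blast
  have cK: "compact (K i)" "convex (K i)" and cL: "compact (L i)" "convex (L i)" for i
    using assms(1,3) by (auto simp: convex_body_def)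
  have zK: "0 \<in> K i" and zL: "0 \<in> L i" for i
    using assms(2,4) interior_subset by blast+
  obtain a b where ab: "a \<bullet> x < b" "\<forall>y\<in>L m. b < a \<bullet> y"
    using separating_hyperplane_closed_point[OF cL(2) compact_imp_closed[OF cL(1)] x(2)] by blast
  \<comment> \<open>The separation theorem puts \<open>x\<close> on the lower side; the sign change
    puts it on the upper side.\<close>
  define u where "u = - a"
  define \<beta> where "\<beta> = - b"
  have u: "\<beta> < x \<bullet> u" "\<And>y. y \<in> L m \<Longrightarrow> y \<bullet> u < \<beta>"
    using ab by (auto simp: u_def \<beta>_def inner_commute)
  have \<beta>: "0 < \<beta>" using u(2)[OF zL] by simp
  \<comment> \<open>The hyperplane that is sent to infinity will approach the supporting hyperplane
    of \<open>K m\<close> with normal \<open>u\<close>, which touches \<open>K m\<close> at this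
    maximiser.\<close>
  have "\<exists>x\<^sub>0\<in>K m. \<forall>y\<in>K m. y \<bullet> u \<le> x\<^sub>0 \<bullet> u"
    using cK(1) x(1) by (intro continuous_attains_sup continuous_intros) auto
  then obtain x\<^sub>0 where x0: "x\<^sub>0 \<in> K m" "\<And>y. y \<in> K m \<Longrightarrow> y \<bullet> u \<le> x\<^sub>0 \<bullet> u" by blast
  define h where "h = x\<^sub>0 \<bullet> u"
  have h: "\<beta> < h" "0 < h" using u(1) x0(2)[OF x(1)] \<beta> by (auto simp: h_def)
  have x0_nz: "x\<^sub>0 \<noteq> 0" and u_nz: "u \<noteq> 0" using h by (auto simp: h_def)

  have "bounded (\<Union>i. K i \<union> L i)"
    by (intro bounded_UN finite) (simp add: compact_imp_bounded[OF cK(1)] compact_imp_bounded[OF cL(1)])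
  then obtain R where R: "R > 0" "\<And>y. y \<in> (\<Union>i. K i \<union> L i) \<Longrightarrow> norm y \<le> R"
    unfolding bounded_pos by blast
  have RK: "norm y \<le> R" if "y \<in> K i" for y i using R(2) that by blast
  have RL: "norm y \<le> R" if "y \<in> L i" for y i using R(2) that by blast
  have "\<exists>e>0. cball 0 e \<subseteq> K i" for i
    using assms(2)[of i] by (simp add: mem_interior_cball)
  then obtain e where e: "\<And>i. e i > 0" "\<And>i. cball 0 (e i) \<subseteq> K i" by metis
  define \<rho> where "\<rho> = Min (range e)"
  have \<rho>: "\<rho> > 0" "\<And>i. \<rho> \<le> e i" using e(1) by (auto simp: \<rho>_def)

  \<comment> \<open>Shrinking by this factor moves every body inside the ball of radius
    \<open>R\<close> into the half-space \<open>y \<bullet> u \<le> h / 2\<close>; the summand 1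
    keeps the denominator positive.\<close>
  define \<mu> where "\<mu> = min 1 (h / (2 * (R * norm u + 1)))"
  have den: "0 < R * norm u + 1" using R(1) by (meson add_nonneg_pos less_imp_le mult_nonneg_nonneg norm_ge_zero zero_less_one)
  have \<mu>: "0 < \<mu>" "\<mu> \<le> 1" using h(2) den by (auto simp: \<mu>_def)
  have small: "(\<mu> *\<^sub>R y) \<bullet> u \<le> h / 2" if "norm y \<le> R" for y
  proof -
    have "y \<bullet> u \<le> R * norm u"
      using norm_cauchy_schwarz[of y u] mult_right_mono[OF that norm_ge_zero[of u]] by linarith
    then have "\<mu> * (y \<bullet> u) \<le> \<mu> * (R * norm u + 1)" using \<mu>(1) by (intro mult_left_mono) auto
    also have "\<dots> \<le> h / (2 * (R * norm u + 1)) * (R * norm u + 1)"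
      using den by (intro mult_right_mono) (auto simp: \<mu>_def)
    also have "\<dots> = h / 2" using den by (simp add: field_simps)
    finally show ?thesis by simp
  qed
  define t where "t = (\<lambda>i. if i = m then 1 else \<mu>)"
  have t: "0 < t i" "t i \<le> 1" for i using \<mu> by (auto simp: t_def)
  \<comment> \<open>A gap to the supporting hyperplane for all scaled bodies other than
    \<open>K m\<close>: \<open>h - \<beta>\<close> for \<open>L m\<close>, which is not shrunk, and
    \<open>h / 2\<close> for the shrunk ones.\<close>
  define \<delta> where "\<delta> = min (h - \<beta>) (h / 2)"
  have \<delta>: "0 < \<delta>" using h by (simp add: \<delta>_def)
  have tL: "y \<bullet> u \<le> h - \<delta>" "norm y \<le> R" if y: "y \<in> (\<lambda>x. t i *\<^sub>R x) ` L i" for i y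
  proof -
    obtain z where z: "z \<in> L i" "y = t i *\<^sub>R z" using y by blast
    show "y \<bullet> u \<le> h - \<delta>"
      using small[OF RL[OF z(1)]] u(2)[of z] z by (auto simp: t_def \<delta>_def min_def split: if_splits)
    show "norm y \<le> R"
      using RL[OF z(1)] t[of i] R(1) mult_mono[of "t i" 1 "norm z" R] by (simp add: z(2))
  qed
  have tK: "norm y \<le> R" "y \<bullet> u \<le> h" "i \<noteq> m \<Longrightarrow> y \<bullet> u \<le> h - \<delta>" if y: "y \<in> (\<lambda>x. t i *\<^sub>R x) ` K i" for i y
  proof -
    obtain z where z: "z \<in> K i" "y = t i *\<^sub>R z" using y by blast
    show "norm y \<le> R"
      using RK[OF z(1)] t[of i] R(1) mult_mono[of "t i" 1 "norm z" R] by (simp add: z(2))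
    show "y \<bullet> u \<le> h"
      using small[OF RK[OF z(1)]] x0(2)[of z] z h(2) by (auto simp: t_def h_def split: if_splits)
    show "y \<bullet> u \<le> h - \<delta>" if "i \<noteq> m"
      using small[OF RK[OF z(1)]] z that by (auto simp: t_def \<delta>_def min_def)
  qed

  \<comment> \<open>Length of an axis vector contained in the image of each shrunk
    \<open>K i\<close> for all \<open>\<epsilon> \<le> 1\<close>: the length
    \<open>\<mu> * \<rho>\<close> available before mapping, divided by an upper bound for the
    denominator at that point.\<close>
  define r where "r = \<mu> * \<rho> / (h + 1 + \<mu> * \<rho> * norm u)"
  have den_r: "0 < h + 1 + \<mu> * \<rho> * norm u"
    using h(2) \<mu>(1) \<rho>(1) by (meson add_pos_nonneg add_pos_pos less_imp_le mult_nonneg_nonneg norm_ge_zero zero_less_one)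
  have r: "r > 0" using den_r \<mu>(1) \<rho>(1) by (simp add: r_def)
  obtain \<tau> :: "'n \<Rightarrow> 'n" where \<tau>: "det (\<chi> i. if i = m then x\<^sub>0 else r *\<^sub>R axis (\<tau> i) 1) \<noteq> 0"
    using det_replace_row_nonzero[OF x0_nz, of r m] r by blast
  \<comment> \<open>Test points for the lower bound; they do not depend on
    \<open>\<epsilon>\<close>.\<close>
  define w where "w = (\<lambda>i. if i = m then x\<^sub>0 else r *\<^sub>R axis (\<tau> i) 1)"
  \<comment> \<open>A common radius for two cases: \<open>R\<close> bounds the rescaled image of
    \<open>K m\<close>, and \<open>R / \<delta>\<close> the images of the other
    \<open>K i\<close>.\<close>
  define R' where "R' = R / \<delta> + R"
  define c where "c = (exp (- 2 * R') / 8) ^ CARD('n) * (det (\<chi> i. w i))\<^sup>2 / fact CARD('n)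
      * measure lebesgue (cball (0::real^'n) 1)"
  define C where "C = 2 ^ CARD('n) * measure lebesgue (cball (0::real^'n) (CARD('n) * (R / \<delta>)))"
  have "c > 0"
    using \<tau> content_cball_pos[of 1 "0 :: real^'n"] by (simp add: c_def w_def)
  have "C \<ge> 0" by (simp add: C_def)

  \<comment> \<open>Since \<open>c\<close> and \<open>C\<close> do not depend on
    \<open>\<epsilon>\<close>, this fails for small \<open>\<epsilon>\<close>. The factor
    \<open>\<epsilon>\<close> comes from rescaling the only image that blows up, that of
    \<open>K m\<close>.\<close>
  have main: "c \<le> \<epsilon> * C" if \<epsilon>: "0 < \<epsilon>" "\<epsilon> \<le> 1" for \<epsilon>
  proof -
    let ?F = "cut u (h + \<epsilon>)"
    define P where "P = (\<lambda>i. ?F ` (\<lambda>x. t i *\<^sub>R x) ` K i)"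
    define Q where "Q = (\<lambda>i. ?F ` (\<lambda>x. t i *\<^sub>R x) ` L i)"
    define s where "s = (\<lambda>i. if i = m then \<epsilon> else 1)"
    have normF: "norm (?F y) \<le> R / \<delta>" if "norm y \<le> R" "y \<bullet> u \<le> h - \<delta>" for y
    proof -
      have "norm (?F y) = norm y / (h + \<epsilon> - y \<bullet> u)"
        using that(2) \<delta> \<epsilon>(1) by (simp add: cut_def)
      also have "\<dots> \<le> R / \<delta>" using that \<delta> \<epsilon>(1) R(1) by (intro frac_le) auto
      finally show ?thesis .
    qed
    have bodyP: "convex_body (P i)" for i
      unfolding P_def
    proof (rule convex_body_cut)
      show "y \<bullet> u < h + \<epsilon>" if "y \<in> (\<lambda>x. t i *\<^sub>R x) ` K i" for y
        using tK(2)[OF that] \<epsilon>(1) by simp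
    qed (use cK assms(2) t in \<open>auto intro!: compact_scaling convex_scaling zero_in_interior_scaleR\<close>)
    have bodyQ: "convex_body (Q i)" for i
      unfolding Q_def
    proof (rule convex_body_cut)
      show "y \<bullet> u < h + \<epsilon>" if "y \<in> (\<lambda>x. t i *\<^sub>R x) ` L i" for y
        using tL(1)[OF that] \<epsilon>(1) \<delta> by simp
    qed (use cL assms(4) t in \<open>auto intro!: compact_scaling convex_scaling zero_in_interior_scaleR\<close>)
    have z_scaled: "0 \<in> (\<lambda>x. t i *\<^sub>R x) ` K i" "0 \<in> (\<lambda>x. t i *\<^sub>R x) ` L i" for i
      using imageI[OF zK[of i], of "\<lambda>x. t i *\<^sub>R x"] imageI[OF zL[of i], of "\<lambda>x. t i *\<^sub>R x"]
      by (simp_all only: scaleR_zero_right)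
    have zP: "0 \<in> P i" and zQ: "0 \<in> Q i" for i
      unfolding P_def Q_def
      using imageI[OF z_scaled(1)[of i], of ?F] imageI[OF z_scaled(2)[of i], of ?F] by (simp_all only: cut_0)
    have sP: "s i > 0" for i using \<epsilon>(1) by (simp add: s_def)

    have "mixed_volume P \<le> mixed_volume Q"
      unfolding P_def Q_def
    proof (rule assms(5))
      show "fractional_linear_map {x. x \<bullet> u < h + \<epsilon>} ?F"
        using u_nz h(2) \<epsilon>(1) by (intro fractional_linear_map_cut) auto
      show "(\<lambda>x. t i *\<^sub>R x) ` K i \<subseteq> {x. x \<bullet> u < h + \<epsilon>} \<and> (\<lambda>x. t i *\<^sub>R x) ` L i \<subseteq> {x. x \<bullet> u < h + \<epsilon>}" for i
        using tK(2) tL(1) \<epsilon>(1) \<delta> by fastforce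
    qed (rule t(1))
    also have "mixed_volume Q \<le> C"
      unfolding C_def
    proof (rule mixed_volume_upper_bound[OF bodyQ zQ])
      show "Q i \<subseteq> cball 0 (R / \<delta>)" for i
      proof
        fix y assume "y \<in> Q i"
        then obtain z where z: "z \<in> (\<lambda>x. t i *\<^sub>R x) ` L i" "y = ?F z" unfolding Q_def by blast
        show "y \<in> cball 0 (R / \<delta>)"
          using normF[OF tL(2,1)[OF z(1)]] by (simp add: z(2))
      qed
    qed
    finally have upper: "mixed_volume P \<le> C" .

    have "c \<le> mixed_volume (\<lambda>i. (\<lambda>x. s i *\<^sub>R x) ` P i)"
      unfolding c_def
    proof (rule mixed_volume_lower_bound)
      show "convex_body ((\<lambda>x. s i *\<^sub>R x) ` P i)" for i
      proof -
        have "interior ((\<lambda>x. s i *\<^sub>R x) ` P i) = (\<lambda>x. s i *\<^sub>R x) ` interior (P i)"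
          using sP[of i] by (intro interior_injective_linear_image) (auto simp: inj_on_def intro!: linearI simp: algebra_simps)
        then show ?thesis
          using bodyP[of i] unfolding convex_body_def by (auto intro: compact_scaling convex_scaling)
      qed
      show "0 \<in> (\<lambda>x. s i *\<^sub>R x) ` P i" for i
        using zP[of i] by (auto simp: image_iff intro!: bexI[of _ 0])
      show "w i \<in> (\<lambda>x. s i *\<^sub>R x) ` P i" for i
      proof (cases "i = m")
        case True
        \<comment> \<open>At \<open>x\<^sub>0\<close> the denominator is exactly
          \<open>\<epsilon>\<close>, so the rescaling cancels it.\<close>
        have "x\<^sub>0 = s i *\<^sub>R ?F (t i *\<^sub>R x\<^sub>0)"
          using \<epsilon>(1) by (simp add: True s_def t_def cut_def h_def)
        then show ?thesis using x0(1) True unfolding P_def w_def by auto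
      next
        case False
        define v where "v = (\<mu> * \<rho>) *\<^sub>R axis (\<tau> i) (1::real)"
        define d where "d = h + \<epsilon> - v \<bullet> u"
        have "\<rho> *\<^sub>R axis (\<tau> i) 1 \<in> K i"
          using e(2)[of i] \<rho> by (auto simp: subset_iff)
        then have v: "v \<in> (\<lambda>x. t i *\<^sub>R x) ` K i"
          using False by (intro image_eqI) (simp_all add: v_def t_def)
        have nv: "norm v = \<mu> * \<rho>" using \<mu>(1) \<rho>(1) by (simp add: v_def)
        have d: "0 < d" using tK(2)[OF v] \<epsilon>(1) by (simp add: d_def)
        have d_le: "d \<le> h + 1 + \<mu> * \<rho> * norm u"
          using Cauchy_Schwarz_ineq2[of v u] \<epsilon>(2) unfolding nv d_def by linarith
        \<comment> \<open>\<open>w i\<close> is the image of \<open>v\<close> shrunk by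
          \<open>q \<le> 1\<close>, hence lies in \<open>P i\<close> by convexity together with
          0.\<close>
        define q where "q = d / (h + 1 + \<mu> * \<rho> * norm u)"
        have q: "0 \<le> q" "q \<le> 1" using d d_le den_r by (simp_all add: q_def)
        have "?F v \<in> P i" using v unfolding P_def by blast
        then have "(1 - q) *\<^sub>R 0 + q *\<^sub>R ?F v \<in> P i"
          using bodyP[of i] zP[of i] q by (intro convexD) (auto simp: convex_body_def)
        moreover have "q *\<^sub>R ?F v = w i"
        proof -
          have "?F v = (1 / d) *\<^sub>R v" by (simp add: cut_def d_def)
          then have "q *\<^sub>R ?F v = (1 / (h + 1 + \<mu> * \<rho> * norm u)) *\<^sub>R v"
            using d by (simp add: q_def)
          then show ?thesis using False by (simp add: w_def r_def v_def)
        qed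
        ultimately show ?thesis using False by (simp add: s_def)
      qed
      show "(\<lambda>x. s i *\<^sub>R x) ` P i \<subseteq> cball 0 R'" for i
      proof
        fix y assume "y \<in> (\<lambda>x. s i *\<^sub>R x) ` P i"
        then obtain z where z: "z \<in> (\<lambda>x. t i *\<^sub>R x) ` K i" "y = s i *\<^sub>R ?F z" unfolding P_def by blast
        have "norm y \<le> R'"
        proof (cases "i = m")
          case True
          \<comment> \<open>On all of \<open>K m\<close> the denominator is at least
            \<open>\<epsilon>\<close>, so the rescaled map does not increase norms.\<close>
          have "0 < h + \<epsilon> - z \<bullet> u" "\<epsilon> \<le> h + \<epsilon> - z \<bullet> u" using tK(2)[OF z(1)] \<epsilon>(1) by auto
          then have "\<epsilon> / (h + \<epsilon> - z \<bullet> u) \<le> 1" by simp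
          have "norm y = \<epsilon> / (h + \<epsilon> - z \<bullet> u) * norm z"
            using \<open>0 < h + \<epsilon> - z \<bullet> u\<close> \<epsilon>(1) by (simp add: z(2) True s_def cut_def)
          also have "\<dots> \<le> 1 * R"
            using \<open>\<epsilon> / (h + \<epsilon> - z \<bullet> u) \<le> 1\<close> tK(1)[OF z(1)] by (intro mult_mono) auto
          finally show ?thesis using R(1) \<delta> by (simp add: R'_def add_increasing)
        next
          case False
          then show ?thesis
            using normF[OF tK(1)[OF z(1)] tK(3)[OF z(1) False]] R(1) by (simp add: z(2) s_def R'_def)
        qed
        then show "y \<in> cball 0 R'" by simp
      qed
    qed
    also have "\<dots> = (\<Prod>i\<in>UNIV. s i) * mixed_volume P"
      using bodyP zP by (rule mixed_volume_scale) (simp add: less_imp_le sP)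
    also have "(\<Prod>i\<in>UNIV. s i) = \<epsilon>"
      by (simp add: s_def prod.delta)
    also have "\<epsilon> * mixed_volume P \<le> \<epsilon> * C"
      using upper \<epsilon>(1) by simp
    finally show "c \<le> \<epsilon> * C" .
  qed
  \<comment> \<open>Small enough that \<open>\<epsilon> * C \<le> c / 2\<close>; using
    \<open>C + 1\<close> avoids a division by zero.\<close>
  define \<epsilon> where "\<epsilon> = min 1 (c / (2 * (C + 1)))"
  have \<epsilon>: "0 < \<epsilon>" "\<epsilon> \<le> 1" using \<open>c > 0\<close> \<open>C \<ge> 0\<close> by (auto simp: \<epsilon>_def)
  have "\<epsilon> * C \<le> c / (2 * (C + 1)) * (C + 1)"
    using \<open>C \<ge> 0\<close> \<epsilon> \<open>c > 0\<close> by (intro mult_mono) (auto simp: \<epsilon>_def)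
  also have "\<dots> = c / 2" using \<open>C \<ge> 0\<close> by (simp add: field_simps)
  finally show False using main[OF \<epsilon>] \<open>c > 0\<close> by simp
qed

end
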